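(* Consider the system for the unknowns $u_1,u_2,U,v_1,v_2,V,w_1,w_2,W$, in terms of the independent variables $x_1,x_2,X,y_1,y_2,Y,z_1,z_2,Z$, consisting of the matrix equation $$M_{12}(u_1,u_2,U)M_{13}(v_1,v_2,V)M_{23}(w_1,w_2,W)=M_{23}(z_1,z_2,Z)M_{13}(y_1,y_2,Y)M_{12}(x_1,x_2,X)$$ together with $U-u_1u_2U^2=X-x_1x_2X^2$. Put $$E=1+x_2y_1z_2Z+(y_1y_2Y-1)[x_1(x_2+y_2z_1Y)X+z_1z_2Z].$$ Then this system has a unique solution, given by the map $T:(x_1,x_2,X,y_1,y_2,Y,z_1,z_2,Z)\mapsto(u_1,u_2,U,v_1,v_2,V,w_1,w_2,W)$ defined by $$u_1=\frac{E\,[x_1X(y_1y_2Y-1)+y_1z_2Z]\,Y}{(x_1x_2X-1)X(z_1z_2Z-1)^2Z},\quad u_2=(x_2+y_2z_1Y)\frac{Z}{Y},\quad U=\frac{(x_1x_2X-1)X(z_1z_2Z-1)}{E},$$ $$v_1=\frac{y_1+x_1z_1X(y_1y_2Y-1)}{E\,X},\quad v_2=\frac{(x_1x_2X-1)X(y_2Y+x_2z_2Z)(z_1z_2Z-1)}{E\,Y},\quad V=\frac{E\,Y}{(x_1x_2X-1)(z_1z_2Z-1)},$$ $$w_1=\frac{x_2y_1+z_1(y_1y_2Y-1)}{x_1x_2X-1},\quad w_2=\frac{(x_1y_2XY+z_2Z)\,E}{(x_1x_2X-1)(z_1z_2Z-1)Z},\quad W=\frac{(x_1x_2X-1)(z_1z_2Z-1)Z}{E}.$$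 Moreover, $T$ is a nine-dimensional birational tetrahedron map.
   Context: Here $M(x_1,x_2,X)=\begin{pmatrix} X & x_1X\\ x_2X & 1\end{pmatrix}$. For a $2\times2$ matrix $M=\begin{pmatrix}A&B\\C&D\end{pmatrix}$ one sets $$M_{12}=\begin{pmatrix} A&B&0\\ C&D&0\\ 0&0&1\end{pmatrix},\quad M_{13}=\begin{pmatrix} A&0&B\\ 0&1&0\\ C&0&D\end{pmatrix},\quad M_{23}=\begin{pmatrix} 1&0&0\\ 0&A&B\\ 0&C&D\end{pmatrix}.$$ All maps are rational maps, and identities between them (and solvability of the system) are understood generically, i.e. in the field of rational functions over $\mathbb C$ in the independent variables. Birational means having a rational inverse. Tetrahedron map: a (rational) map $T:\mathcal X^3\to\mathcal X^3$ is a tetrahedron map if $$T^{123}\circ T^{145}\circ T^{246}\circ T^{356}=T^{356}\circ T^{246}\circ T^{145}\circ T^{123}$$ on $\mathcal X^6$, where $T^{ijk}$ acts as $T$ on the $i$-th, $j$-th, $k$-th factors (in this order) of $\mathcal X^6$ and as the identity on the other factors. Here $\mathcal X=\mathbb C^3$, the three factors having coordinates $(x_1,x_2,X)$, $(y_1,y_2,Y)$, $(z_1,z_2,Z)$, and the image having coordinates $(u_1,u_2,U)$, $(v_1,v_2,V)$, $(w_1,w_2,W)$. *)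

theory Defs
  imports
    "HOL-Library.Poly_Mapping"
    "HOL-Library.Product_Lexorder"
    "HOL-Computational_Algebra.Fraction_Field"
    "HOL-Analysis.Cartesian_Space"
begin

section \<open>Rational functions over the complex numbers\<close>

text \<open>
  A polynomial in variables indexed by \<open>'v\<close> is a finitely supported function from exponent
  vectors to coefficients. The linear order on \<open>'v\<close> that appears below is only there because the
  library derives the absence of zero divisors from it.
\<close>

type_synonym 'v mpoly = "('v \<Rightarrow>\<^sub>0 nat) \<Rightarrow>\<^sub>0 complex"

type_synonym 'v ratfun = "'v mpoly fract"

definition ratconst :: "complex \<Rightarrow> 'v::linorder ratfun" where
  "ratconst c = Fraction_Field.Fract (Poly_Mapping.single 0 c) 1"

definition ratvar :: "'v \<Rightarrow> 'v::linorder ratfun" where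
  "ratvar v = Fraction_Field.Fract (Poly_Mapping.single (Poly_Mapping.single v 1) 1) 1"

definition mpoly_eval :: "('v \<Rightarrow> 'w::linorder ratfun) \<Rightarrow> 'v mpoly \<Rightarrow> 'w ratfun" where
  "mpoly_eval a p =
     (\<Sum>m\<in>Poly_Mapping.keys p. ratconst (Poly_Mapping.lookup p m) *
        (\<Prod>v\<in>Poly_Mapping.keys m. a v ^ Poly_Mapping.lookup m v))"

text \<open>
  Substituting rational functions into a rational function is a partial operation: some fraction
  representing it must have a denominator that does not vanish under the substitution. The value
  does not depend on the representing fraction. The condition forces \<open>q \<noteq> 0\<close>.
\<close>

definition regular_at :: "('v \<Rightarrow> 'w::linorder ratfun) \<Rightarrow> 'v::linorder ratfun \<Rightarrow> bool" where
  "regular_at a f \<longleftrightarrow> (\<exists>p q. f = Fraction_Field.Fract p q \<and> mpoly_eval a q \<noteq> 0)"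

definition ratsubst :: "('v \<Rightarrow> 'w::linorder ratfun) \<Rightarrow> 'v::linorder ratfun \<Rightarrow> 'w ratfun" where
  "ratsubst a f =
     (THE y. \<exists>p q. f = Fraction_Field.Fract p q \<and> mpoly_eval a q \<noteq> 0
           \<and> y = mpoly_eval a p / mpoly_eval a q)"


section \<open>Rational maps\<close>

text \<open>
  A rational map from the affine space with coordinates indexed by \<open>'v\<close> to the one with coordinates
  indexed by \<open>'w\<close> is the family of its components.
\<close>

type_synonym ('v, 'w) ratmap = "'w \<Rightarrow> 'v ratfun"

text \<open>
  \<open>ratcomp f g\<close> is \<open>f\<close> after \<open>g\<close>. It is meaningful only under \<open>composable f g\<close>, i.e. if \<open>g\<close> does not
  map into the indeterminacy locus of \<open>f\<close>.
\<close>

definition composable ::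
    "('w::linorder, 'z) ratmap \<Rightarrow> ('v::linorder, 'w) ratmap \<Rightarrow> bool" where
  "composable f g \<longleftrightarrow> (\<forall>i. regular_at g (f i))"

definition ratcomp ::
    "('w::linorder, 'z) ratmap \<Rightarrow> ('v::linorder, 'w) ratmap \<Rightarrow> ('v, 'z) ratmap" where
  "ratcomp f g = (\<lambda>i. ratsubst g (f i))"

definition birational :: "('v::linorder, 'w::linorder) ratmap \<Rightarrow> bool" where
  "birational f \<longleftrightarrow>
     (\<exists>g. composable g f \<and> ratcomp g f = ratvar \<and> composable f g \<and> ratcomp f g = ratvar)"


section \<open>Tetrahedron maps\<close>

text \<open>
  With \<open>\<X>\<close> the affine space with coordinates indexed by \<open>'c\<close>, the coordinates of \<open>\<X>\<^sup>n\<close> are indexed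
  by pairs (factor, coordinate). The factors of \<open>\<X>\<^sup>3\<close> are \<open>1, 2, 3 :: 3\<close> and those of \<open>\<X>\<^sup>6\<close> are
  \<open>1, \<dots>, 6 :: 6\<close>; in these types \<open>3 = 0\<close> and \<open>6 = 0\<close> respectively, but the listed indices are
  pairwise distinct and exhaust the type.
\<close>

definition act_on ::
    "(3 \<times> 'c::linorder, 3 \<times> 'c) ratmap \<Rightarrow> 'n::linorder \<Rightarrow> 'n \<Rightarrow> 'n \<Rightarrow> ('n \<times> 'c, 'n \<times> 'c) ratmap"
  where
  "act_on T i j k = (\<lambda>(l, c).
     let r = ratsubst (\<lambda>(s, d). ratvar (if s = 1 then i else if s = 2 then j else k, d)) in
       if l = i then r (T (1, c))
       else if l = j then r (T (2, c))
       else if l = k then r (T (3, c))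
       else ratvar (l, c))"

definition tetrahedron_map :: "(3 \<times> 'c::{finite,linorder}, 3 \<times> 'c) ratmap \<Rightarrow> bool" where
  "tetrahedron_map T \<longleftrightarrow>
     (let T123 = act_on T (1::6) 2 3;
          T145 = act_on T (1::6) 4 5;
          T246 = act_on T (2::6) 4 6;
          T356 = act_on T (3::6) 5 6
      in composable T246 T356
         \<and> composable T145 (ratcomp T246 T356)
         \<and> composable T123 (ratcomp T145 (ratcomp T246 T356))
         \<and> composable T145 T123
         \<and> composable T246 (ratcomp T145 T123)
         \<and> composable T356 (ratcomp T246 (ratcomp T145 T123))
         \<and> ratcomp T123 (ratcomp T145 (ratcomp T246 T356))
           = ratcomp T356 (ratcomp T246 (ratcomp T145 T123)))"


section \<open>The matrices\<close>

definition emb12 :: "'a::field^2^2 \<Rightarrow> 'a^3^3" where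
  "emb12 A = vector [vector [A$1$1, A$1$2, 0],
                     vector [A$2$1, A$2$2, 0],
                     vector [0,     0,     1]]"

definition emb13 :: "'a::field^2^2 \<Rightarrow> 'a^3^3" where
  "emb13 A = vector [vector [A$1$1, 0, A$1$2],
                     vector [0,     1, 0],
                     vector [A$2$1, 0, A$2$2]]"

definition emb23 :: "'a::field^2^2 \<Rightarrow> 'a^3^3" where
  "emb23 A = vector [vector [1, 0,     0],
                     vector [0, A$1$1, A$1$2],
                     vector [0, A$2$1, A$2$2]]"

definition Mmat :: "'a::field \<Rightarrow> 'a \<Rightarrow> 'a \<Rightarrow> 'a^2^2" where
  "Mmat x1 x2 X = vector [vector [X,      x1 * X],
                          vector [x2 * X, 1]]"

end

theory Submission
  imports Defs "HOL-Analysis.Determinants"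
begin

text \<open>
  The entries of the product \<open>M12 M13 M23\<close> determine its three factors up to a one-parameter gauge,
  which the condition fixing the first determinant \<open>U - u1 u2 U\<^sup>2\<close> removes; this gives
  uniqueness. The solution preserves all three determinants. Transposition interchanges the two sides of the matrix equation, so by uniqueness
  the inverse of \<open>T\<close> is \<open>T\<close> conjugated by \<open>x1 \<leftrightarrow> x2\<close>. In dimension four, both sides of the
  tetrahedron equation refactorise one and the same matrix as \<open>M12 M13 M23 M14 M24 M34\<close> with the
  same six determinants, and such a factorisation is again unique: strip off the last column, then
  the one before it. All genericity conditions hold because the point \<open>x1 = x2 = 0, X = 1\<close> (in
  every factor) is fixed by \<open>T\<close> and all denominators are nonzero there.
\<close>

section \<open>Substitution into rational functions\<close>

definition monom_eval :: "('v \<Rightarrow> 'a::comm_semiring_1) \<Rightarrow> ('v \<Rightarrow>\<^sub>0 nat) \<Rightarrow> 'a" where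
  "monom_eval a m = (\<Prod>v\<in>Poly_Mapping.keys m. a v ^ Poly_Mapping.lookup m v)"

lemma monom_eval_superset:
  assumes "finite S" "Poly_Mapping.keys m \<subseteq> S"
  shows "monom_eval a m = (\<Prod>v\<in>S. a v ^ Poly_Mapping.lookup m v)"
  unfolding monom_eval_def using assms
  by (intro prod.mono_neutral_left) (auto simp: in_keys_iff)

lemma monom_eval_add: "monom_eval a (m + n) = monom_eval a m * monom_eval a n"
proof -
  let ?S = "Poly_Mapping.keys m \<union> Poly_Mapping.keys n"
  have "monom_eval a (m + n) = (\<Prod>v\<in>?S. a v ^ Poly_Mapping.lookup (m + n) v)"
    by (rule monom_eval_superset) (simp_all add: keys_add)
  also have "\<dots> = (\<Prod>v\<in>?S. a v ^ Poly_Mapping.lookup m v) * (\<Prod>v\<in>?S. a v ^ Poly_Mapping.lookup n v)"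
    by (simp add: lookup_add power_add prod.distrib)
  also have "\<dots> = monom_eval a m * monom_eval a n"
    by (simp add: monom_eval_superset[of ?S m] monom_eval_superset[of ?S n])
  finally show ?thesis .
qed

lemma monom_eval_0 [simp]: "monom_eval a 0 = 1"
  by (simp add: monom_eval_def)

lemma ratconst_0 [simp]: "ratconst 0 = 0"
  by (simp add: ratconst_def Zero_fract_def)

lemma ratconst_1 [simp]: "ratconst 1 = 1"
  by (simp add: ratconst_def One_fract_def)

lemma ratconst_add: "ratconst (c + d) = ratconst c + ratconst d"
  by (simp add: ratconst_def single_add)

lemma ratconst_mult: "ratconst (c * d) = ratconst c * ratconst d"
  by (simp add: ratconst_def mult_single)

lemma mpoly_eval_superset:
  assumes "finite S" "Poly_Mapping.keys p \<subseteq> S"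
  shows "mpoly_eval a p = (\<Sum>m\<in>S. ratconst (Poly_Mapping.lookup p m) * monom_eval a m)"
  unfolding mpoly_eval_def monom_eval_def[symmetric] using assms
  by (intro sum.mono_neutral_left) (auto simp: in_keys_iff)

lemma mpoly_eval_0 [simp]: "mpoly_eval a 0 = 0"
  by (simp add: mpoly_eval_def)

lemma mpoly_eval_single:
  "mpoly_eval a (Poly_Mapping.single m c) = ratconst c * monom_eval a m"
  by (subst mpoly_eval_superset[of "{m}"]) auto

lemma mpoly_eval_1 [simp]: "mpoly_eval a 1 = 1"
  using mpoly_eval_single[of a 0 1] by simp

lemma mpoly_eval_add: "mpoly_eval a (p + q) = mpoly_eval a p + mpoly_eval a q"
proof -
  let ?S = "Poly_Mapping.keys p \<union> Poly_Mapping.keys q"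
  have "mpoly_eval a (p + q)
      = (\<Sum>m\<in>?S. ratconst (Poly_Mapping.lookup (p + q) m) * monom_eval a m)"
    by (rule mpoly_eval_superset) (simp_all add: keys_add)
  also have "\<dots> = mpoly_eval a p + mpoly_eval a q"
    by (simp add: mpoly_eval_superset[of ?S p] mpoly_eval_superset[of ?S q]
        lookup_add ratconst_add distrib_right sum.distrib)
  finally show ?thesis .
qed

text \<open>Setting a fresh key amounts to adding one term, so \<open>update_induct\<close> becomes
  an induction over sums of single terms, the form that suits additive maps.\<close>

lemma mpoly_induct [case_names zero single_add]:
  fixes p :: "'k \<Rightarrow>\<^sub>0 'c::comm_monoid_add"
  assumes "P 0" and "\<And>m c p. P p \<Longrightarrow> P (Poly_Mapping.single m c + p)"
  shows "P p"
proof (induction p rule: update_induct)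
  case (update f k v)
  have "Poly_Mapping.update k v f = Poly_Mapping.single k v + f"
    using update
    by (intro poly_mapping_eqI)
      (auto simp: lookup_update lookup_add lookup_single in_keys_iff when_def)
  then show ?case using assms(2) update by simp
qed (rule assms(1))

lemma mpoly_eval_mult: "mpoly_eval a (p * q) = mpoly_eval a p * mpoly_eval a q"
proof (induction p rule: mpoly_induct)
  case (single_add m c p)
  have "mpoly_eval a (Poly_Mapping.single m c * q)
      = mpoly_eval a (Poly_Mapping.single m c) * mpoly_eval a q"
    by (induction q rule: mpoly_induct)
      (simp_all add: distrib_left mpoly_eval_add mult_single mpoly_eval_single
        monom_eval_add ratconst_mult mult_ac)
  then show ?case
    using single_add by (simp add: distrib_right mpoly_eval_add)
qed simp

lemma mpoly_eval_uminus: "mpoly_eval a (- p) = - mpoly_eval a p"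
  using mpoly_eval_add[of a p "- p"] by (simp add: eq_neg_iff_add_eq_0 add.commute)

text \<open>The graph of the partial field homomorphism \<^const>\<open>ratsubst\<close>.\<close>

definition substs_to ::
    "('v \<Rightarrow> 'w::linorder ratfun) \<Rightarrow> 'v::linorder ratfun \<Rightarrow> 'w ratfun \<Rightarrow> bool" where
  "substs_to a f y \<longleftrightarrow> (\<exists>p q. f = Fraction_Field.Fract p q \<and> mpoly_eval a q \<noteq> 0
     \<and> y = mpoly_eval a p / mpoly_eval a q)"

lemma substs_toE:
  assumes "substs_to a f y"
  obtains p q where "f = Fraction_Field.Fract p q" "q \<noteq> 0" "mpoly_eval a q \<noteq> 0"
    "y = mpoly_eval a p / mpoly_eval a q"
  using assms unfolding substs_to_def by (metis mpoly_eval_0)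

text \<open>Two fractions for the same \<open>f\<close> satisfy \<open>p * q' = p' * q\<close>;
  evaluating this identity gives equal quotients. Hence the \<open>THE\<close> in
  \<open>ratsubst\<close> is well defined.\<close>

lemma substs_to_unique:
  assumes "substs_to a f y" "substs_to a f y'"
  shows "y = y'"
proof -
  obtain p q where f: "f = Fraction_Field.Fract p q" "q \<noteq> 0"
    and y: "mpoly_eval a q \<noteq> 0" "y = mpoly_eval a p / mpoly_eval a q"
    using assms(1) by (rule substs_toE)
  obtain p' q' where f': "f = Fraction_Field.Fract p' q'" "q' \<noteq> 0"
    and y': "mpoly_eval a q' \<noteq> 0" "y' = mpoly_eval a p' / mpoly_eval a q'"
    using assms(2) by (rule substs_toE)
  have "p * q' = p' * q"
    using f f' by (simp add: eq_fract)
  then have "mpoly_eval a p * mpoly_eval a q' = mpoly_eval a p' * mpoly_eval a q"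
    by (metis mpoly_eval_mult)
  then show ?thesis
    using y y' by (simp add: frac_eq_eq)
qed

lemma ratsubst_eqI: "substs_to a f y \<Longrightarrow> ratsubst a f = y"
  unfolding ratsubst_def substs_to_def[symmetric]
  by (rule the_equality) (auto intro: substs_to_unique)

lemma regular_atI: "substs_to a f y \<Longrightarrow> regular_at a f"
  unfolding regular_at_def substs_to_def by blast

section \<open>Substitution and the field operations\<close>

lemma substs_to_0: "substs_to a 0 0"
  unfolding substs_to_def by (intro exI[of _ 0] exI[of _ 1]) (simp add: fract_collapse)

lemma substs_to_1: "substs_to a 1 1"
  unfolding substs_to_def by (intro exI[of _ 1]) (simp add: fract_collapse)

lemma substs_to_ratvar: "substs_to a (ratvar v) (a v)"
  unfolding substs_to_def ratvar_def
  by (intro exI[of _ "Poly_Mapping.single (Poly_Mapping.single v 1) 1"] exI[of _ 1])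
    (simp add: mpoly_eval_single monom_eval_def)

lemma substs_to_add:
  assumes "substs_to a f y" "substs_to a g z"
  shows "substs_to a (f + g) (y + z)"
proof -
  obtain p q where f: "f = Fraction_Field.Fract p q" "q \<noteq> 0"
    and y: "mpoly_eval a q \<noteq> 0" "y = mpoly_eval a p / mpoly_eval a q"
    using assms(1) by (rule substs_toE)
  obtain p' q' where g: "g = Fraction_Field.Fract p' q'" "q' \<noteq> 0"
    and z: "mpoly_eval a q' \<noteq> 0" "z = mpoly_eval a p' / mpoly_eval a q'"
    using assms(2) by (rule substs_toE)
  show ?thesis
    unfolding substs_to_def using f g y z
    by (intro exI[of _ "p * q' + p' * q"] exI[of _ "q * q'"])
      (simp add: mpoly_eval_add mpoly_eval_mult add_frac_eq)
qed

lemma substs_to_mult: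
  assumes "substs_to a f y" "substs_to a g z"
  shows "substs_to a (f * g) (y * z)"
proof -
  obtain p q where f: "f = Fraction_Field.Fract p q" "q \<noteq> 0"
    and y: "mpoly_eval a q \<noteq> 0" "y = mpoly_eval a p / mpoly_eval a q"
    using assms(1) by (rule substs_toE)
  obtain p' q' where g: "g = Fraction_Field.Fract p' q'" "q' \<noteq> 0"
    and z: "mpoly_eval a q' \<noteq> 0" "z = mpoly_eval a p' / mpoly_eval a q'"
    using assms(2) by (rule substs_toE)
  show ?thesis
    unfolding substs_to_def using f g y z
    by (intro exI[of _ "p * p'"] exI[of _ "q * q'"]) (simp add: mpoly_eval_mult)
qed

lemma substs_to_uminus:
  assumes "substs_to a f y"
  shows "substs_to a (- f) (- y)"
proof -
  obtain p q where "f = Fraction_Field.Fract p q" "q \<noteq> 0"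
    "mpoly_eval a q \<noteq> 0" "y = mpoly_eval a p / mpoly_eval a q"
    using assms by (rule substs_toE)
  then show ?thesis
    unfolding substs_to_def
    by (intro exI[of _ "- p"] exI[of _ q]) (simp add: mpoly_eval_uminus)
qed

lemma substs_to_diff:
  "substs_to a f y \<Longrightarrow> substs_to a g z \<Longrightarrow> substs_to a (f - g) (y - z)"
  using substs_to_add[OF _ substs_to_uminus] by fastforce

lemma substs_to_inverse:
  assumes "substs_to a f y" "y \<noteq> 0"
  shows "substs_to a (inverse f) (inverse y)"
proof -
  obtain p q where "f = Fraction_Field.Fract p q" "q \<noteq> 0"
    "mpoly_eval a q \<noteq> 0" "y = mpoly_eval a p / mpoly_eval a q"
    using assms(1) by (rule substs_toE)
  then show ?thesis
    unfolding substs_to_def using assms(2)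
    by (intro exI[of _ q] exI[of _ p]) auto
qed

lemma substs_to_divide:
  "substs_to a f y \<Longrightarrow> substs_to a g z \<Longrightarrow> z \<noteq> 0 \<Longrightarrow> substs_to a (f / g) (y / z)"
  unfolding divide_inverse by (intro substs_to_mult substs_to_inverse)

text \<open>The zero function takes only the value 0. Genericity conditions on rational functions
  are derived from this by evaluating at a single point.\<close>

lemma substs_to_nonzero: "substs_to a f y \<Longrightarrow> y \<noteq> 0 \<Longrightarrow> f \<noteq> 0"
  using substs_to_0 substs_to_unique by blast

lemma substs_to_power: "substs_to a f y \<Longrightarrow> substs_to a (f ^ n) (y ^ n)"
  by (induction n) (auto intro: substs_to_1 substs_to_mult)

lemmas substs_to_intros =
  substs_to_0 substs_to_1 substs_to_add substs_to_mult substs_to_diff substs_to_divide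
  substs_to_power


section \<open>The refactorisation problem\<close>

text \<open>Entry (3,3) is 1 on both sides, which leaves eight equations.\<close>

lemma Mmat_refactorisation_iff:
  "emb12 (Mmat u1 u2 U) ** emb13 (Mmat v1 v2 V) ** emb23 (Mmat w1 w2 W)
     = emb23 (Mmat z1 z2 Z) ** emb13 (Mmat y1 y2 Y) ** emb12 (Mmat x1 x2 X)
   \<longleftrightarrow> U * V = X * Y \<and> u1 * U * W + U * (v1 * V) * (w2 * W) = Y * (x1 * X)
     \<and> U * (v1 * V) + u1 * U * (w1 * W) = y1 * Y
     \<and> u2 * U * V = Z * (x2 * X) + z1 * Z * (y2 * Y) * X
     \<and> W + u2 * U * (v1 * V) * (w2 * W) = Z + z1 * Z * (y2 * Y) * (x1 * X)
     \<and> u2 * U * (v1 * V) + w1 * W = z1 * Z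
     \<and> v2 * V = z2 * Z * (x2 * X) + y2 * Y * X
     \<and> w2 * W = z2 * Z + y2 * Y * (x1 * X)"
  by (simp add: matrix_matrix_mult_def vec_eq_iff sum_3 forall_3 emb12_def emb13_def emb23_def
      Mmat_def vector_3 vector_2) (auto simp: ac_simps)

lemma Mmat_product_eq_iff:
  "emb12 (Mmat u1 u2 U) ** emb13 (Mmat v1 v2 V) ** emb23 (Mmat w1 w2 W)
     = emb12 (Mmat u1' u2' U') ** emb13 (Mmat v1' v2' V') ** emb23 (Mmat w1' w2' W')
   \<longleftrightarrow> U * V = U' * V'
     \<and> u1 * U * W + U * (v1 * V) * (w2 * W) = u1' * U' * W' + U' * (v1' * V') * (w2' * W')
     \<and> U * (v1 * V) + u1 * U * (w1 * W) = U' * (v1' * V') + u1' * U' * (w1' * W')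
     \<and> u2 * U * V = u2' * U' * V'
     \<and> W + u2 * U * (v1 * V) * (w2 * W) = W' + u2' * U' * (v1' * V') * (w2' * W')
     \<and> u2 * U * (v1 * V) + w1 * W = u2' * U' * (v1' * V') + w1' * W'
     \<and> v2 * V = v2' * V' \<and> w2 * W = w2' * W'"
  by (simp add: matrix_matrix_mult_def vec_eq_iff sum_3 forall_3 emb12_def emb13_def emb23_def
      Mmat_def vector_3 vector_2) (auto simp: ac_simps)

text \<open>Once the products \<open>u1 * U\<close>, \<open>u2 * U\<close> and so on are simplified,
  clearing denominators reduces the entries to polynomial identities. The field is arbitrary so that
  the formulas apply to all tuples of rational functions, not only to the variables.\<close>

lemma tetrahedron_solution:
  fixes x1 x2 X y1 y2 Y z1 z2 Z :: "'a::field"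
  defines "E \<equiv> 1 + x2 * y1 * z2 * Z
               + (y1 * y2 * Y - 1) * (x1 * (x2 + y2 * z1 * Y) * X + z1 * z2 * Z)"
    and "d \<equiv> x1 * x2 * X - 1" and "e \<equiv> z1 * z2 * Z - 1"
  assumes nz: "X \<noteq> 0" "Y \<noteq> 0" "Z \<noteq> 0" "d \<noteq> 0" "e \<noteq> 0" "E \<noteq> 0"
    and u: "u1 = (E * (x1 * X * (y1 * y2 * Y - 1) + y1 * z2 * Z) * Y) / (d * X * e^2 * Z)"
      "u2 = (x2 + y2 * z1 * Y) * (Z / Y)" "U = (d * X * e) / E"
    and v: "v1 = (y1 + x1 * z1 * X * (y1 * y2 * Y - 1)) / (E * X)"
      "v2 = (d * X * (y2 * Y + x2 * z2 * Z) * e) / (E * Y)" "V = (E * Y) / (d * e)"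
    and w: "w1 = (x2 * y1 + z1 * (y1 * y2 * Y - 1)) / d"
      "w2 = ((x1 * y2 * X * Y + z2 * Z) * E) / (d * e * Z)" "W = (d * e * Z) / E"
  shows "emb12 (Mmat u1 u2 U) ** emb13 (Mmat v1 v2 V) ** emb23 (Mmat w1 w2 W)
      = emb23 (Mmat z1 z2 Z) ** emb13 (Mmat y1 y2 Y) ** emb12 (Mmat x1 x2 X)"
    and "U - u1 * u2 * U^2 = X - x1 * x2 * X^2"
proof -
  define g where "g = y1 * y2 * Y - 1"
  have uU: "u1 * U = (x1 * X * g + y1 * z2 * Z) * Y / (e * Z)"
    unfolding u g_def using nz by (simp add: field_simps power2_eq_square)
  have u2U: "u2 * U = (x2 + y2 * z1 * Y) * Z * d * X * e / (E * Y)"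
    unfolding u using nz by (simp add: field_simps)
  have v1V: "v1 * V = (y1 + x1 * z1 * X * g) * Y / (d * e * X)"
    unfolding v g_def using nz by (simp add: field_simps)
  have v2V: "v2 * V = X * (y2 * Y + x2 * z2 * Z)"
    unfolding v using nz by (simp add: field_simps)
  have w1W: "w1 * W = (x2 * y1 + z1 * g) * e * Z / E"
    unfolding w g_def using nz by (simp add: field_simps)
  have w2W: "w2 * W = x1 * y2 * X * Y + z2 * Z"
    unfolding w using nz by (simp add: field_simps)
  have e11: "U * V = X * Y"
    unfolding u(3) v(3) using nz by simp
  have e31: "v2 * V = z2 * Z * (x2 * X) + y2 * Y * X"
    and e32: "w2 * W = z2 * Z + y2 * Y * (x1 * X)"
    unfolding v2V w2W by (simp_all add: algebra_simps)
  have e12: "u1 * U * W + U * (v1 * V) * (w2 * W) = Y * (x1 * X)"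
  proof -
    \<comment> \<open>What remains of entry (1,2) after taking out the factor \<open>Y / E\<close>
      of the left side.\<close>
    have "(x1 * X * g + y1 * z2 * Z) * d + (y1 + x1 * z1 * X * g) * (x1 * y2 * X * Y + z2 * Z)
        = x1 * X * E"
      unfolding g_def d_def E_def by algebra
    then show ?thesis
      unfolding uU v1V w2W unfolding u(3) w(3) using nz by (simp add: divide_simps) algebra
  qed
  have e13: "U * (v1 * V) + u1 * U * (w1 * W) = y1 * Y"
  proof -
    have "(y1 + x1 * z1 * X * g) + (x1 * X * g + y1 * z2 * Z) * (x2 * y1 + z1 * g) = y1 * E"
      unfolding g_def E_def by algebra
    then show ?thesis
      unfolding uU v1V w1W unfolding u(3) using nz by (simp add: divide_simps) algebra
  qed
  have e21: "u2 * U * V = Z * (x2 * X) + z1 * Z * (y2 * Y) * X"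
    unfolding u2U unfolding v(3) using nz by (simp add: field_simps)
  have e22: "W + u2 * U * (v1 * V) * (w2 * W) = Z + z1 * Z * (y2 * Y) * (x1 * X)"
  proof -
    have "d * e + (x2 + y2 * z1 * Y) * (y1 + x1 * z1 * X * g) * (x1 * y2 * X * Y + z2 * Z)
        = (1 + z1 * (y2 * Y) * (x1 * X)) * E"
      unfolding g_def d_def e_def E_def by algebra
    then show ?thesis
      unfolding u2U v1V w2W unfolding w(3) using nz by (simp add: divide_simps) algebra
  qed
  have e23: "u2 * U * (v1 * V) + w1 * W = z1 * Z"
  proof -
    have "(x2 + y2 * z1 * Y) * (y1 + x1 * z1 * X * g) + (x2 * y1 + z1 * g) * e = z1 * E"
      unfolding g_def e_def E_def by algebra
    then show ?thesis
      unfolding u2U v1V w1W using nz by (simp add: divide_simps) algebra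
  qed
  show "emb12 (Mmat u1 u2 U) ** emb13 (Mmat v1 v2 V) ** emb23 (Mmat w1 w2 W)
      = emb23 (Mmat z1 z2 Z) ** emb13 (Mmat y1 y2 Y) ** emb12 (Mmat x1 x2 X)"
    unfolding Mmat_refactorisation_iff using e11 e12 e13 e21 e22 e23 e31 e32 by blast
  \<comment> \<open>Since \<open>(u1 * U) * (u2 * U)\<close> is this product times
    \<open>d * X / E\<close>, the part with \<open>e\<close> cancels against \<open>U\<close> and
    leaves \<open>- (d * X)\<close>.\<close>
  have "(x1 * X * g + y1 * z2 * Z) * (x2 + y2 * z1 * Y) = e + E"
    unfolding g_def e_def E_def by algebra
  moreover have "U - u1 * u2 * U^2 = U - (u1 * U) * (u2 * U)"
    by (simp add: power2_eq_square)
  ultimately have "U - u1 * u2 * U^2 = d * X * e / E - d * X * (e + E) / E"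
    unfolding uU u2U unfolding u(3) using nz by (simp add: divide_simps)
  also have "\<dots> = - (d * X)"
    using nz by (simp add: field_simps)
  finally show "U - u1 * u2 * U^2 = X - x1 * x2 * X^2"
    by (simp add: d_def algebra_simps power2_eq_square)
qed

text \<open>The determinants of the blocks in rows 2, 3 are the lower right 2x2 minors of the two
  sides. The middle determinant follows from multiplicativity of \<open>det\<close>, the outer two
  being equal and nonzero.\<close>

lemma det_Mmat_refactorisation:
  fixes X :: "'a::field"
  assumes "emb12 (Mmat u1 u2 U) ** emb13 (Mmat v1 v2 V) ** emb23 (Mmat w1 w2 W)
      = emb23 (Mmat z1 z2 Z) ** emb13 (Mmat y1 y2 Y) ** emb12 (Mmat x1 x2 X)"
    and "U - u1 * u2 * U^2 = X - x1 * x2 * X^2"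
    and "X - x1 * x2 * X^2 \<noteq> 0" "Z - z1 * z2 * Z^2 \<noteq> 0"
  shows "V - v1 * v2 * V^2 = Y - y1 * y2 * Y^2" "W - w1 * w2 * W^2 = Z - z1 * z2 * Z^2"
proof -
  have eqs: "W + u2 * U * (v1 * V) * (w2 * W) = Z + z1 * Z * (y2 * Y) * (x1 * X)"
    "u2 * U * (v1 * V) + w1 * W = z1 * Z" "w2 * W = z2 * Z + y2 * Y * (x1 * X)"
    using assms(1) unfolding Mmat_refactorisation_iff by blast+
  have "W - w1 * w2 * W^2
      = (W + u2 * U * (v1 * V) * (w2 * W)) - (u2 * U * (v1 * V) + w1 * W) * (w2 * W)"
    by algebra
  also have "\<dots> = (Z + z1 * Z * (y2 * Y) * (x1 * X)) - (z1 * Z) * (w2 * W)"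
    by (simp only: eqs(1,2))
  also have "\<dots> = (Z + z1 * Z * (y2 * Y) * (x1 * X)) - (z1 * Z) * (z2 * Z + y2 * Y * (x1 * X))"
    by (simp only: eqs(3))
  also have "\<dots> = Z - z1 * z2 * Z^2"
    by algebra
  finally show W: "W - w1 * w2 * W^2 = Z - z1 * z2 * Z^2" .
  have "det (emb12 (Mmat a b c)) = c - a * b * c^2" "det (emb13 (Mmat a b c)) = c - a * b * c^2"
    "det (emb23 (Mmat a b c)) = c - a * b * c^2" for a b c :: 'a
    by (simp_all add: det_3 emb12_def emb13_def emb23_def Mmat_def vector_3 vector_2
        power2_eq_square algebra_simps)
  then have "(U - u1 * u2 * U^2) * (V - v1 * v2 * V^2) * (W - w1 * w2 * W^2)
      = (Z - z1 * z2 * Z^2) * (Y - y1 * y2 * Y^2) * (X - x1 * x2 * X^2)"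
    using arg_cong[OF assms(1), of det] by (simp only: det_mul)
  then show "V - v1 * v2 * V^2 = Y - y1 * y2 * Y^2"
    unfolding W assms(2) using assms(3,4) by (auto simp: mult_ac)
qed

text \<open>
  The gauge freedom \<open>U \<mapsto> t U\<close>, \<open>V \<mapsto> V / t\<close> of the matrix equation is fixed by the
  determinant of the first factor.
\<close>

lemma Mmat_refactorisation_unique:
  fixes X :: "'a::field"
  assumes L: "emb12 (Mmat u1 u2 U) ** emb13 (Mmat v1 v2 V) ** emb23 (Mmat w1 w2 W)
      = emb12 (Mmat u1' u2' U') ** emb13 (Mmat v1' v2' V') ** emb23 (Mmat w1' w2' W')"
    and det: "U - u1 * u2 * U^2 = U' - u1' * u2' * U'^2" "W - w1 * w2 * W^2 = W' - w1' * w2' * W'^2"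
    and nz: "U \<noteq> 0" "V \<noteq> 0" "U - u1 * u2 * U^2 \<noteq> 0" "W - w1 * w2 * W^2 \<noteq> 0"
  shows "u1 = u1' \<and> u2 = u2' \<and> U = U' \<and> v1 = v1' \<and> v2 = v2' \<and> V = V'
    \<and> w1 = w1' \<and> w2 = w2' \<and> W = W'"
proof -
  have L: "U * V = U' * V'"
    "u1 * U * W + U * (v1 * V) * (w2 * W) = u1' * U' * W' + U' * (v1' * V') * (w2' * W')"
    "U * (v1 * V) + u1 * U * (w1 * W) = U' * (v1' * V') + u1' * U' * (w1' * W')"
    "u2 * U * V = u2' * U' * V'"
    "W + u2 * U * (v1 * V) * (w2 * W) = W' + u2' * U' * (v1' * V') * (w2' * W')"
    "u2 * U * (v1 * V) + w1 * W = u2' * U' * (v1' * V') + w1' * W'"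
    "v2 * V = v2' * V'" "w2 * W = w2' * W'"
    using L unfolding Mmat_product_eq_iff by blast+
  have nz': "U' \<noteq> 0" "V' \<noteq> 0"
    using L(1) nz by auto
  have u2: "u2 = u2'"
  proof -
    have "u2 * (U' * V') = u2' * (U' * V')"
      using L(1,4) by (metis mult.assoc)
    then show ?thesis using nz' by simp
  qed
  have b: "u1 * U = u1' * U'"
  proof -
    \<comment> \<open>The minor of rows 1, 3 and columns 2, 3 is \<open>u1 * U\<close> times the
      last determinant.\<close>
    have "u1 * U * (W - w1 * w2 * W^2)
        = (u1 * U * W + U * (v1 * V) * (w2 * W)) - (U * (v1 * V) + u1 * U * (w1 * W)) * (w2 * W)"
      by algebra
    also have "\<dots> = (u1' * U' * W' + U' * (v1' * V') * (w2' * W'))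
        - (U' * (v1' * V') + u1' * U' * (w1' * W')) * (w2 * W)"
      by (simp only: L(2,3))
    also have "\<dots> = u1' * U' * (W' - w1' * w2' * W'^2)"
      unfolding L(8) by algebra
    finally show ?thesis
      using det(2) nz(4) by simp
  qed
  have f: "1 - u1 * U * u2 \<noteq> 0"
    using nz(3) by (auto simp: power2_eq_square algebra_simps)
  have U: "U = U'"
  proof -
    \<comment> \<open>With \<open>u1 * U\<close> and \<open>u2\<close> known, the first determinant
      is linear in \<open>U\<close> with a nonzero coefficient; here the gauge is fixed.\<close>
    have "U * (1 - u1 * U * u2) = U' * (1 - u1' * U' * u2')"
      using det(1) by (simp add: power2_eq_square algebra_simps)
    then show ?thesis
      using b u2 f by simp
  qed
  then have V: "V = V'" and u1: "u1 = u1'"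
    using L(1) b nz by auto
  have W: "W = W'"
  proof -
    \<comment> \<open>Subtracting \<open>u2\<close> times row 1 from row 2 eliminates
      \<open>v1\<close>; column 2 yields \<open>W\<close>, and column 3 below yields
      \<open>w1 * W\<close>.\<close>
    have "W * (1 - u1 * U * u2) = (W + u2 * U * (v1 * V) * (w2 * W))
        - u2 * (u1 * U * W + U * (v1 * V) * (w2 * W))"
      by algebra
    also have "\<dots> = (W' + u2' * U' * (v1' * V') * (w2' * W'))
        - u2 * (u1' * U' * W' + U' * (v1' * V') * (w2' * W'))"
      by (simp only: L(2,5))
    also have "\<dots> = W' * (1 - u1 * U * u2)"
      unfolding u2 b by algebra
    finally show ?thesis
      using f by simp
  qed
  have w: "w1 * W = w1' * W'"
  proof -
    have "w1 * W * (1 - u1 * U * u2) = (u2 * U * (v1 * V) + w1 * W)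
        - u2 * (U * (v1 * V) + u1 * U * (w1 * W))"
      by algebra
    also have "\<dots> = (u2' * U' * (v1' * V') + w1' * W')
        - u2 * (U' * (v1' * V') + u1' * U' * (w1' * W'))"
      by (simp only: L(3,6))
    also have "\<dots> = w1' * W' * (1 - u1 * U * u2)"
      unfolding u2 b by algebra
    finally show ?thesis
      using f by simp
  qed
  have "W \<noteq> 0"
    using nz(4) by auto
  then have "w1 = w1'" "w2 = w2'"
    using w L(8) W by auto
  moreover have "v2 = v2'" "v1 = v1'"
    using L(3,7) U V b w nz by auto
  ultimately show ?thesis
    using u1 u2 U V W by blast
qed

section \<open>The map on points over a field\<close>

text \<open>Stated over any field, so that \<open>Tmap ratvar\<close> is the rational map itself and
  \<open>Tmap g\<close> its composite with a nondegenerate tuple \<open>g\<close> of rational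
  functions.\<close>

definition Tmap :: "(3 \<times> 3 \<Rightarrow> 'a::field) \<Rightarrow> 3 \<times> 3 \<Rightarrow> 'a" where
  "Tmap s =
     (let x1 = s (1, 1); x2 = s (1, 2); X = s (1, 3);
          y1 = s (2, 1); y2 = s (2, 2); Y = s (2, 3);
          z1 = s (3, 1); z2 = s (3, 2); Z = s (3, 3);
          E = 1 + x2 * y1 * z2 * Z
               + (y1 * y2 * Y - 1) * (x1 * (x2 + y2 * z1 * Y) * X + z1 * z2 * Z)
      in (\<lambda>_. 0)(
        (1, 1) := (E * (x1 * X * (y1 * y2 * Y - 1) + y1 * z2 * Z) * Y)
                    / ((x1 * x2 * X - 1) * X * (z1 * z2 * Z - 1)^2 * Z),
        (1, 2) := (x2 + y2 * z1 * Y) * (Z / Y),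
        (1, 3) := ((x1 * x2 * X - 1) * X * (z1 * z2 * Z - 1)) / E,
        (2, 1) := (y1 + x1 * z1 * X * (y1 * y2 * Y - 1)) / (E * X),
        (2, 2) := ((x1 * x2 * X - 1) * X * (y2 * Y + x2 * z2 * Z) * (z1 * z2 * Z - 1)) / (E * Y),
        (2, 3) := (E * Y) / ((x1 * x2 * X - 1) * (z1 * z2 * Z - 1)),
        (3, 1) := (x2 * y1 + z1 * (y1 * y2 * Y - 1)) / (x1 * x2 * X - 1),
        (3, 2) := ((x1 * y2 * X * Y + z2 * Z) * E)
                    / ((x1 * x2 * X - 1) * (z1 * z2 * Z - 1) * Z),
        (3, 3) := ((x1 * x2 * X - 1) * (z1 * z2 * Z - 1) * Z) / E))"

text \<open>Collects the factors of the denominators in \<open>Tmap\<close>; the last one is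
  \<open>E\<close>.\<close>

definition nondegenerate :: "(3 \<times> 3 \<Rightarrow> 'a::field) \<Rightarrow> bool" where
  "nondegenerate s \<longleftrightarrow>
     s (1, 3) \<noteq> 0 \<and> s (2, 3) \<noteq> 0 \<and> s (3, 3) \<noteq> 0
     \<and> s (1, 1) * s (1, 2) * s (1, 3) - 1 \<noteq> 0 \<and> s (3, 1) * s (3, 2) * s (3, 3) - 1 \<noteq> 0
     \<and> 1 + s (1, 2) * s (2, 1) * s (3, 2) * s (3, 3)
         + (s (2, 1) * s (2, 2) * s (2, 3) - 1)
           * (s (1, 1) * (s (1, 2) + s (2, 2) * s (3, 1) * s (2, 3)) * s (1, 3)
              + s (3, 1) * s (3, 2) * s (3, 3)) \<noteq> 0"

definition refactorises :: "(3 \<times> 3 \<Rightarrow> 'a::field) \<Rightarrow> (3 \<times> 3 \<Rightarrow> 'a) \<Rightarrow> bool" where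
  "refactorises s t \<longleftrightarrow>
     emb12 (Mmat (t (1, 1)) (t (1, 2)) (t (1, 3))) ** emb13 (Mmat (t (2, 1)) (t (2, 2)) (t (2, 3)))
       ** emb23 (Mmat (t (3, 1)) (t (3, 2)) (t (3, 3)))
     = emb23 (Mmat (s (3, 1)) (s (3, 2)) (s (3, 3))) ** emb13 (Mmat (s (2, 1)) (s (2, 2)) (s (2, 3)))
       ** emb12 (Mmat (s (1, 1)) (s (1, 2)) (s (1, 3)))
     \<and> t (1, 3) - t (1, 1) * t (1, 2) * t (1, 3)^2 = s (1, 3) - s (1, 1) * s (1, 2) * s (1, 3)^2"

text \<open>The determinant of \<open>Mmat (p 1) (p 2) (p 3)\<close>.\<close>

definition pdet :: "(3 \<Rightarrow> 'a::comm_ring_1) \<Rightarrow> 'a" where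
  "pdet p = p 3 - p 1 * p 2 * p 3 ^ 2"

definition blk :: "('n \<times> 'c \<Rightarrow> 'a) \<Rightarrow> 'n \<Rightarrow> 'c \<Rightarrow> 'a" where
  "blk s l = (\<lambda>c. s (l, c))"

lemma exhaust_3_3:
  fixes i :: "3 \<times> 3"
  obtains "i = (1, 1)" | "i = (1, 2)" | "i = (1, 3)" | "i = (2, 1)" | "i = (2, 2)" | "i = (2, 3)"
    | "i = (3, 1)" | "i = (3, 2)" | "i = (3, 3)"
  using exhaust_3[of "fst i"] exhaust_3[of "snd i"] by (cases i) auto

lemma Tmap_simps:
  fixes s :: "3 \<times> 3 \<Rightarrow> 'a::field"
  defines "x1 \<equiv> s (1, 1)" and "x2 \<equiv> s (1, 2)" and "X \<equiv> s (1, 3)"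
    and "y1 \<equiv> s (2, 1)" and "y2 \<equiv> s (2, 2)" and "Y \<equiv> s (2, 3)"
    and "z1 \<equiv> s (3, 1)" and "z2 \<equiv> s (3, 2)" and "Z \<equiv> s (3, 3)"
  defines "E \<equiv> 1 + x2 * y1 * z2 * Z
               + (y1 * y2 * Y - 1) * (x1 * (x2 + y2 * z1 * Y) * X + z1 * z2 * Z)"
  shows "Tmap s (1, 1) = (E * (x1 * X * (y1 * y2 * Y - 1) + y1 * z2 * Z) * Y)
                    / ((x1 * x2 * X - 1) * X * (z1 * z2 * Z - 1)^2 * Z)"
    and "Tmap s (1, 2) = (x2 + y2 * z1 * Y) * (Z / Y)"
    and "Tmap s (1, 3) = ((x1 * x2 * X - 1) * X * (z1 * z2 * Z - 1)) / E"
    and "Tmap s (2, 1) = (y1 + x1 * z1 * X * (y1 * y2 * Y - 1)) / (E * X)"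
    and "Tmap s (2, 2)
      = ((x1 * x2 * X - 1) * X * (y2 * Y + x2 * z2 * Z) * (z1 * z2 * Z - 1)) / (E * Y)"
    and "Tmap s (2, 3) = (E * Y) / ((x1 * x2 * X - 1) * (z1 * z2 * Z - 1))"
    and "Tmap s (3, 1) = (x2 * y1 + z1 * (y1 * y2 * Y - 1)) / (x1 * x2 * X - 1)"
    and "Tmap s (3, 2) = ((x1 * y2 * X * Y + z2 * Z) * E)
                    / ((x1 * x2 * X - 1) * (z1 * z2 * Z - 1) * Z)"
    and "Tmap s (3, 3) = ((x1 * x2 * X - 1) * (z1 * z2 * Z - 1) * Z) / E"
  unfolding assms Tmap_def Let_def by simp_all

lemma nondegenerate_dets:
  assumes "nondegenerate s"
  shows "s (1, 3) - s (1, 1) * s (1, 2) * s (1, 3)^2 \<noteq> 0"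
    and "s (3, 3) - s (3, 1) * s (3, 2) * s (3, 3)^2 \<noteq> 0"
proof -
  have "a - b * c * a^2 = - a * (b * c * a - 1)" for a b c :: 'a
    by algebra
  then show "s (1, 3) - s (1, 1) * s (1, 2) * s (1, 3)^2 \<noteq> 0"
    and "s (3, 3) - s (3, 1) * s (3, 2) * s (3, 3)^2 \<noteq> 0"
    using assms by (simp_all add: nondegenerate_def)
qed

lemma refactorises_Tmap: "nondegenerate s \<Longrightarrow> refactorises s (Tmap s)"
  unfolding refactorises_def nondegenerate_def
  by (intro conjI tetrahedron_solution[OF _ _ _ _ _ _ Tmap_simps]) auto

text \<open>A solution \<open>t\<close> and \<open>Tmap s\<close> have the same matrix product and,
  by \<open>det_Mmat_refactorisation\<close>, the same determinants, so gauge-fixed uniqueness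
  identifies them.\<close>

lemma refactorises_iff:
  assumes "nondegenerate s"
  shows "refactorises s t \<longleftrightarrow> t = Tmap s"
proof
  let ?T = "Tmap s"
  assume t: "refactorises s t"
  note s = refactorises_Tmap[OF assms]
  note d = nondegenerate_dets[OF assms]
  note dt = det_Mmat_refactorisation[OF conjunct1[OF t[unfolded refactorises_def]]
      conjunct2[OF t[unfolded refactorises_def]] d]
  note ds = det_Mmat_refactorisation[OF conjunct1[OF s[unfolded refactorises_def]]
      conjunct2[OF s[unfolded refactorises_def]] d]
  have nz: "Tmap s (1, 3) \<noteq> 0" "Tmap s (2, 3) \<noteq> 0"
    using assms by (simp_all add: nondegenerate_def Tmap_simps)
  have "t i = Tmap s i" for i
  proof -
    \<comment> \<open>\<open>Tmap s\<close> takes the side on which \<open>U\<close> and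
      \<open>V\<close> must be nonzero, as its formulas show this directly.\<close>
    have "?T (1,1) = t (1,1) \<and> ?T (1,2) = t (1,2) \<and> ?T (1,3) = t (1,3)
      \<and> ?T (2,1) = t (2,1) \<and> ?T (2,2) = t (2,2) \<and> ?T (2,3) = t (2,3)
      \<and> ?T (3,1) = t (3,1) \<and> ?T (3,2) = t (3,2) \<and> ?T (3,3) = t (3,3)"
      by (rule Mmat_refactorisation_unique)
        (use s t d dt(2) ds(2) nz in \<open>simp_all add: refactorises_def\<close>)
    then show ?thesis
      by (cases i rule: exhaust_3_3) auto
  qed
  then show "t = Tmap s" by (rule ext)
qed (simp add: refactorises_Tmap assms)

lemma pdet_Tmap:
  assumes "nondegenerate s"
  shows "pdet (blk (Tmap s) l) = pdet (blk s l)"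
proof -
  note s = refactorises_Tmap[OF assms, unfolded refactorises_def]
  show ?thesis
    using exhaust_3[of l] s
      det_Mmat_refactorisation[OF conjunct1[OF s] conjunct2[OF s] nondegenerate_dets[OF assms]]
    by (auto simp: pdet_def blk_def)
qed

section \<open>Transposition symmetry\<close>

definition swap_offdiag :: "'n \<times> 3 \<Rightarrow> 'n \<times> 3" where
  "swap_offdiag = (\<lambda>(l, c). (l, if c = 1 then 2 else if c = 2 then 1 else c))"

lemma swap_offdiag_swap_offdiag [simp]: "swap_offdiag \<circ> swap_offdiag = id"
  by (auto simp: swap_offdiag_def fun_eq_iff)

lemma transpose_emb_Mmat:
  "transpose (emb12 (Mmat a b c)) = emb12 (Mmat b a c)"
  "transpose (emb13 (Mmat a b c)) = emb13 (Mmat b a c)"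
  "transpose (emb23 (Mmat a b c)) = emb23 (Mmat b a c)"
  by (simp_all add: transpose_def vec_eq_iff forall_3 emb12_def emb13_def emb23_def
      Mmat_def vector_3 vector_2)

text \<open>Transposition reverses both products and swaps the off-diagonal parameters of each
  factor; the determinant condition is symmetric in these.\<close>

lemma refactorises_swap_offdiag:
  assumes "refactorises s t"
  shows "refactorises (t \<circ> swap_offdiag) (s \<circ> swap_offdiag)"
  using arg_cong[OF conjunct1[OF assms[unfolded refactorises_def]], of transpose]
    conjunct2[OF assms[unfolded refactorises_def]]
  by (simp add: refactorises_def swap_offdiag_def matrix_transpose_mul transpose_emb_Mmat
      matrix_mul_assoc mult_ac)

text \<open>Transposing the matrix equation interchanges its two sides.\<close>

lemma Tmap_swap_offdiag_Tmap:
  assumes "nondegenerate s" "nondegenerate (Tmap s \<circ> swap_offdiag)"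
  shows "Tmap (Tmap s \<circ> swap_offdiag) \<circ> swap_offdiag = s"
proof -
  have "s \<circ> swap_offdiag = Tmap (Tmap s \<circ> swap_offdiag)"
    using refactorises_swap_offdiag[OF refactorises_Tmap[OF assms(1)]] refactorises_iff[OF assms(2)]
    by blast
  then show ?thesis
    by (metis comp_assoc comp_id swap_offdiag_swap_offdiag)
qed

section \<open>Factorisations in dimension four\<close>

text \<open>
  The elementary matrix with the block \<^const>\<open>Mmat\<close> in rows and columns \<open>i, j\<close>, as an operator on
  column vectors.
\<close>

definition lax :: "'i \<Rightarrow> 'i \<Rightarrow> (3 \<Rightarrow> 'a::field) \<Rightarrow> ('i \<Rightarrow> 'a) \<Rightarrow> 'i \<Rightarrow> 'a" where
  "lax i j p f = f(i := p 3 * f i + p 1 * p 3 * f j, j := p 2 * p 3 * f i + f j)"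

text \<open>The adjugate of the block divided by its determinant.\<close>

definition lax_inv :: "'i \<Rightarrow> 'i \<Rightarrow> (3 \<Rightarrow> 'a::field) \<Rightarrow> ('i \<Rightarrow> 'a) \<Rightarrow> 'i \<Rightarrow> 'a" where
  "lax_inv i j p f = f(i := (f i - p 1 * p 3 * f j) / pdet p,
                       j := (p 3 * f j - p 2 * p 3 * f i) / pdet p)"

lemma lax_lax_inv:
  assumes "i \<noteq> j" "pdet p \<noteq> 0"
  shows "lax i j p (lax_inv i j p f) = f"
proof -
  have "p 3 * ((f i - p 1 * p 3 * f j) / pdet p)
      + p 1 * p 3 * ((p 3 * f j - p 2 * p 3 * f i) / pdet p) = pdet p * f i / pdet p"
    by (simp add: pdet_def add_divide_distrib[symmetric] algebra_simps power2_eq_square)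
  moreover have "p 2 * p 3 * ((f i - p 1 * p 3 * f j) / pdet p)
      + (p 3 * f j - p 2 * p 3 * f i) / pdet p = pdet p * f j / pdet p"
    by (simp add: pdet_def add_divide_distrib[symmetric] algebra_simps power2_eq_square)
  ultimately show ?thesis
    using assms by (auto simp: lax_def lax_inv_def fun_eq_iff)
qed

lemma lax_inv_lax:
  assumes "i \<noteq> j" "pdet p \<noteq> 0"
  shows "lax_inv i j p (lax i j p f) = f"
proof -
  have "p 3 * f i + p 1 * p 3 * f j - p 1 * p 3 * (p 2 * p 3 * f i + f j) = f i * pdet p"
    "p 3 * (p 2 * p 3 * f i + f j) - p 2 * p 3 * (p 3 * f i + p 1 * p 3 * f j) = f j * pdet p"
    by (simp_all add: pdet_def algebra_simps power2_eq_square)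
  then show ?thesis
    using assms by (simp add: lax_def lax_inv_def fun_eq_iff)
qed

lemma lax_eq_iff:
  "i \<noteq> j \<Longrightarrow> pdet p \<noteq> 0 \<Longrightarrow> lax i j p f = lax i j p g \<longleftrightarrow> f = g"
  by (metis lax_inv_lax)

lemma lax_commute:
  assumes "{i, j} \<inter> {k, l} = {}"
  shows "lax i j p (lax k l q f) = lax k l q (lax i j p f)"
  using assms by (auto simp: lax_def fun_eq_iff)

text \<open>The 3x3 equation carried over to three chosen coordinates of a longer vector, with both
  sides fixing all others.\<close>

lemma lax_refactorises:
  assumes "refactorises s t" and "distinct [i, j, k]"
  shows "lax i j (blk t 1) (lax i k (blk t 2) (lax j k (blk t 3) f))
       = lax j k (blk s 3) (lax i k (blk s 2) (lax i j (blk s 1) f))"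
proof -
  define u1 u2 U v1 v2 V w1 w2 W
    where t: "u1 = t (1, 1)" "u2 = t (1, 2)" "U = t (1, 3)" "v1 = t (2, 1)" "v2 = t (2, 2)"
      "V = t (2, 3)" "w1 = t (3, 1)" "w2 = t (3, 2)" "W = t (3, 3)"
  define x1 x2 X y1 y2 Y z1 z2 Z
    where s: "x1 = s (1, 1)" "x2 = s (1, 2)" "X = s (1, 3)" "y1 = s (2, 1)" "y2 = s (2, 2)"
      "Y = s (2, 3)" "z1 = s (3, 1)" "z2 = s (3, 2)" "Z = s (3, 3)"
  have eqs: "U * V = X * Y" "u1 * U * W + U * (v1 * V) * (w2 * W) = Y * (x1 * X)"
    "U * (v1 * V) + u1 * U * (w1 * W) = y1 * Y"
    "u2 * U * V = Z * (x2 * X) + z1 * Z * (y2 * Y) * X"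
    "W + u2 * U * (v1 * V) * (w2 * W) = Z + z1 * Z * (y2 * Y) * (x1 * X)"
    "u2 * U * (v1 * V) + w1 * W = z1 * Z"
    "v2 * V = z2 * Z * (x2 * X) + y2 * Y * X"
    "w2 * W = z2 * Z + y2 * Y * (x1 * X)"
    using assms(1) unfolding refactorises_def Mmat_refactorisation_iff s t by blast+
  have i: "U * (V * f i + v1 * V * (w2 * W * f j + f k)) + u1 * U * (W * f j + w1 * W * f k)
      = Y * (X * f i + x1 * X * f j) + y1 * Y * f k" (is "?l = ?r")
  proof -
    \<comment> \<open>Collected by \<open>f i\<close>, \<open>f j\<close>, \<open>f k\<close>, the
      coefficients are the matrix entries in \<open>eqs\<close>.\<close>
    have "?l = U * V * f i + (u1 * U * W + U * (v1 * V) * (w2 * W)) * f j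
        + (U * (v1 * V) + u1 * U * (w1 * W)) * f k"
      by algebra
    also have "\<dots> = ?r"
      unfolding eqs(1-3) by algebra
    finally show ?thesis .
  qed
  have j: "u2 * U * (V * f i + v1 * V * (w2 * W * f j + f k)) + (W * f j + w1 * W * f k)
      = Z * (x2 * X * f i + f j) + z1 * Z * (y2 * Y * (X * f i + x1 * X * f j) + f k)"
    (is "?l = ?r")
  proof -
    have "?l = u2 * U * V * f i + (W + u2 * U * (v1 * V) * (w2 * W)) * f j
        + (u2 * U * (v1 * V) + w1 * W) * f k"
      by algebra
    also have "\<dots> = ?r"
      unfolding eqs(4-6) by algebra
    finally show ?thesis .
  qed
  have k: "v2 * V * f i + (w2 * W * f j + f k)
      = z2 * Z * (x2 * X * f i + f j) + (y2 * Y * (X * f i + x1 * X * f j) + f k)"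
    unfolding eqs(7,8) by algebra
  have ne: "i \<noteq> j" "j \<noteq> i" "i \<noteq> k" "k \<noteq> i" "j \<noteq> k" "k \<noteq> j"
    using assms(2) by auto
  show ?thesis
  proof
    fix n
    consider "n = i" | "n = j" | "n = k" | "n \<notin> {i, j, k}" by blast
    then show "lax i j (blk t 1) (lax i k (blk t 2) (lax j k (blk t 3) f)) n
        = lax j k (blk s 3) (lax i k (blk s 2) (lax i j (blk s 1) f)) n"
      by cases (simp_all add: lax_def blk_def ne i j k flip: s t)
  qed
qed

section \<open>Uniqueness of the factorisation, column by column\<close>

text \<open>\<open>p 3\<close> is the determinant plus the product of the off-diagonal entries;
  dividing these entries by it recovers \<open>p 1\<close> and \<open>p 2\<close>.\<close>

lemma block_eqI:
  fixes p q :: "3 \<Rightarrow> 'a::field"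
  assumes "p 3 * p 1 = q 3 * q 1" "p 3 * p 2 = q 3 * q 2" "pdet p = pdet q" "p 3 \<noteq> 0"
  shows "p = q"
proof -
  have "p 3 = pdet p + (p 3 * p 1) * (p 3 * p 2)" "q 3 = pdet q + (q 3 * q 1) * (q 3 * q 2)"
    by (simp_all add: pdet_def power2_eq_square)
  then have "p 3 = q 3"
    using assms by simp
  then have "p c = q c" for c
    using assms exhaust_3[of c] by auto
  then show ?thesis by (rule ext)
qed

text \<open>
  Column \<open>n\<close> of the product is inverted by \<^const>\<open>lax_inv\<close>, which reads off the entries \<open>p 1 * p 3\<close>;
  its row \<open>n\<close> contains the entries \<open>p 2 * p 3\<close>.
\<close>

lemma lax_column_unique:
  fixes K K' :: "('i \<Rightarrow> 'a::field) \<Rightarrow> 'i \<Rightarrow> 'a"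
  assumes eq: "\<And>f. K (lax i n p1 (lax j n p2 (lax k n p3 f)))
                 = K' (lax i n q1 (lax j n q2 (lax k n q3 f)))"
    and K: "\<And>f. K f n = f n" "K ((\<lambda>_. 0)(n := 1)) = (\<lambda>_. 0)(n := 1)"
    and K': "\<And>f. K' f n = f n" "K' ((\<lambda>_. 0)(n := 1)) = (\<lambda>_. 0)(n := 1)" "inj K'"
    and det: "pdet p1 = pdet q1" "pdet p2 = pdet q2" "pdet p3 = pdet q3"
      "pdet p1 \<noteq> 0" "pdet p2 \<noteq> 0" "pdet p3 \<noteq> 0"
    and nz: "p1 3 \<noteq> 0" "p2 3 \<noteq> 0" "p3 3 \<noteq> 0"
    and dist: "distinct [i, j, k, n]"
  shows "p1 = q1 \<and> p2 = q2 \<and> p3 = q3 \<and> K = K'"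
proof -
  let ?e = "\<lambda>m. (\<lambda>_. 0)(m := 1) :: 'i \<Rightarrow> 'a"
  have row: "lax i n p1 (lax j n p2 (lax k n p3 f)) n = lax i n q1 (lax j n q2 (lax k n q3 f)) n"
    for f using fun_cong[OF eq, of f n] by (simp only: K K')
  have c: "p1 3 * p1 2 = q1 3 * q1 2" "p2 3 * p2 2 = q2 3 * q2 2" "p3 3 * p3 2 = q3 3 * q3 2"
    using row[of "?e i"] row[of "?e j"] row[of "?e k"] dist by (auto simp: lax_def mult_ac)
  \<comment> \<open>The preimage of the unit vector at \<open>n\<close> under the three blocks. As
    \<open>K\<close> and \<open>K'\<close> fix that vector and \<open>K'\<close> is injective,
    \<open>f\<close> is also its preimage under the \<open>q\<close> blocks.\<close>
  define f where "f = lax_inv k n p3 (lax_inv j n p2 (lax_inv i n p1 (?e n)))"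
  have "lax i n p1 (lax j n p2 (lax k n p3 f)) = ?e n"
    using dist det by (simp add: f_def lax_lax_inv)
  then have "K' (lax i n q1 (lax j n q2 (lax k n q3 f))) = K' (?e n)"
    using eq[of f] K K' by simp
  then have N': "lax i n q1 (lax j n q2 (lax k n q3 f)) = ?e n"
    using K'(3) by (simp add: inj_def)
  have "lax_inv k n q3 (lax_inv j n q2 (lax_inv i n q1 (lax i n q1 (lax j n q2 (lax k n q3 f))))) = f"
    using dist det by (simp add: lax_inv_lax)
  then have f': "f = lax_inv k n q3 (lax_inv j n q2 (lax_inv i n q1 (?e n)))"
    unfolding N' by simp
  have p1: "p1 = q1"
  proof (rule block_eqI[OF _ c(1) det(1) nz(1)])
    show "p1 3 * p1 1 = q1 3 * q1 1"
      using f'[unfolded f_def, THEN fun_cong, of i] dist det by (auto simp: lax_inv_def mult_ac)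
  qed
  \<comment> \<open>The entry of \<open>f\<close> at \<open>j\<close> carries the factor
    \<open>p1 3 / pdet p1\<close> inherited from coordinate \<open>n\<close>, hence the order
    \<open>p1\<close>, \<open>p2\<close>, \<open>p3\<close>.\<close>
  have p2: "p2 = q2"
  proof (rule block_eqI[OF _ c(2) det(2) nz(2)])
    show "p2 3 * p2 1 = q2 3 * q2 1"
      using f'[unfolded f_def, THEN fun_cong, of j] dist det nz
      by (auto simp: lax_inv_def mult_ac p1)
  qed
  have p3: "p3 = q3"
  proof (rule block_eqI[OF _ c(3) det(3) nz(3)])
    show "p3 3 * p3 1 = q3 3 * q3 1"
      using f'[unfolded f_def, THEN fun_cong, of k] dist det nz
      by (auto simp: lax_inv_def mult_ac p1 p2)
  qed
  \<comment> \<open>The blocks now agree and are surjective, so they cancel on the right.\<close>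
  have "K g = K' g" for g
    using eq[of "lax_inv k n p3 (lax_inv j n p2 (lax_inv i n p1 g))"] dist det
    by (simp add: p1 p2 p3 lax_lax_inv)
  then show ?thesis
    using p1 p2 p3 by auto
qed

text \<open>The parameters of the identity matrix.\<close>

definition trivial_block :: "3 \<Rightarrow> 'a::field" where
  "trivial_block c = (if c = 3 then 1 else 0)"

lemma lax_trivial_block [simp]: "lax i j trivial_block f = f"
  by (auto simp: lax_def trivial_block_def fun_eq_iff)

lemma pdet_trivial_block [simp]: "pdet trivial_block = 1"
  by (simp add: pdet_def trivial_block_def)

text \<open>Ordered so that the factors involving row 4 come last and can be stripped first. Rows of
  type \<open>nat\<close> leave room for padding, for instance in row 0.\<close>

definition lax_product :: "(6 \<Rightarrow> 3 \<Rightarrow> 'a::field) \<Rightarrow> (nat \<Rightarrow> 'a) \<Rightarrow> nat \<Rightarrow> 'a" where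
  "lax_product p f = lax 1 2 (p 1) (lax 1 3 (p 2) (lax 2 3 (p 3)
     (lax 1 4 (p 4) (lax 2 4 (p 5) (lax 3 4 (p 6) f)))))"

lemma exhaust_6:
  fixes l :: 6
  shows "l = 1 \<or> l = 2 \<or> l = 3 \<or> l = 4 \<or> l = 5 \<or> l = 6"
proof (cases l)
  case (of_int z)
  then have "z = 0 \<or> z = 1 \<or> z = 2 \<or> z = 3 \<or> z = 4 \<or> z = 5" by auto
  moreover have "(0::6) = 6" by simp
  ultimately show ?thesis using of_int(1) by auto
qed

text \<open>
  Shorter columns are padded with trivial blocks in unused rows, so that
  \<open>lax_column_unique\<close> applies to all three columns.
\<close>

lemma lax_product_inject:
  assumes eq: "lax_product p = lax_product q"
    and det: "\<And>l. pdet (p l) = pdet (q l)" "\<And>l. pdet (p l) \<noteq> 0"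
    and nz: "\<And>l. p l 3 \<noteq> 0"
  shows "p = q"
proof -
  have detq: "pdet (q l) \<noteq> 0" for l
    using det[of l] by simp
  let ?K = "\<lambda>p f. lax (1::nat) 2 (p 1) (lax 1 3 (p 2) (lax 2 3 (p 3) f))"
  have inj3: "inj (?K q)"
    by (auto intro!: injI simp: lax_eq_iff detq)
  have "p 4 = q 4 \<and> p 5 = q 5 \<and> p 6 = q 6 \<and> ?K p = ?K q"
  proof (rule lax_column_unique)
    show "?K p (lax 1 4 (p 4) (lax 2 4 (p 5) (lax 3 4 (p 6) f)))
        = ?K q (lax 1 4 (q 4) (lax 2 4 (q 5) (lax 3 4 (q 6) f)))" for f
      using fun_cong[OF eq, of f] by (simp add: lax_product_def)
  qed (use det nz inj3 in \<open>simp_all add: lax_def fun_eq_iff\<close>)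
  then have p456: "p 4 = q 4" "p 5 = q 5" "p 6 = q 6" and eq3: "?K p = ?K q"
    by blast+
  have "p 2 = q 2 \<and> p 3 = q 3 \<and> trivial_block = (trivial_block :: 3 \<Rightarrow> 'a)
      \<and> lax (1::nat) 2 (p 1) = lax 1 2 (q 1)"
  proof (rule lax_column_unique)
    show "lax 1 2 (p 1) (lax 1 3 (p 2) (lax 2 3 (p 3) (lax 0 3 trivial_block f)))
        = lax (1::nat) 2 (q 1) (lax 1 3 (q 2) (lax 2 3 (q 3) (lax 0 3 trivial_block f)))" for f
      using fun_cong[OF eq3, of f] by simp
    show "inj (lax (1::nat) 2 (q 1))"
      by (auto intro!: injI simp: lax_eq_iff detq)
  qed (use det nz in \<open>simp_all add: lax_def fun_eq_iff trivial_block_def[of 3]\<close>)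
  then have p23: "p 2 = q 2" "p 3 = q 3" and eq2: "lax (1::nat) 2 (p 1) = lax 1 2 (q 1)"
    by blast+
  have "p 1 = q 1 \<and> trivial_block = (trivial_block :: 3 \<Rightarrow> 'a)
      \<and> trivial_block = (trivial_block :: 3 \<Rightarrow> 'a) \<and> (\<lambda>f::nat \<Rightarrow> 'a. f) = (\<lambda>f. f)"
  proof (rule lax_column_unique)
    show "lax 1 2 (p 1) (lax 0 2 trivial_block (lax 3 2 trivial_block f))
        = lax (1::nat) 2 (q 1) (lax 0 2 trivial_block (lax 3 2 trivial_block f))" for f
      using fun_cong[OF eq2, of f] by simp
  qed (use det nz in \<open>simp_all add: trivial_block_def[of 3]\<close>)
  then have "p 1 = q 1"
    by blast
  then have "p l = q l" for l
    using exhaust_6[of l] p23 p456 by auto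
  then show ?thesis by (rule ext)
qed

section \<open>The tetrahedron equation on points\<close>

definition pick :: "'n \<Rightarrow> 'n \<Rightarrow> 'n \<Rightarrow> ('n \<times> 3 \<Rightarrow> 'a) \<Rightarrow> 3 \<times> 3 \<Rightarrow> 'a" where
  "pick i j k s = (\<lambda>(m, c). s (if m = 1 then i else if m = 2 then j else k, c))"

text \<open>The pointwise counterpart of \<open>act_on\<close>, over any field.\<close>

definition Tact :: "'n \<Rightarrow> 'n \<Rightarrow> 'n \<Rightarrow> ('n \<times> 3 \<Rightarrow> 'a::field) \<Rightarrow> 'n \<times> 3 \<Rightarrow> 'a" where
  "Tact i j k s = (\<lambda>(l, c).
     if l = i then Tmap (pick i j k s) (1, c)
     else if l = j then Tmap (pick i j k s) (2, c)
     else if l = k then Tmap (pick i j k s) (3, c)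
     else s (l, c))"

lemma blk_Tact:
  "blk (Tact i j k s) l =
     (if l = i then blk (Tmap (pick i j k s)) 1
      else if l = j then blk (Tmap (pick i j k s)) 2
      else if l = k then blk (Tmap (pick i j k s)) 3
      else blk s l)"
  by (auto simp: blk_def Tact_def)

lemma blk_pick: "blk (pick i j k s) 1 = blk s i" "blk (pick i j k s) 2 = blk s j"
  "blk (pick i j k s) 3 = blk s k"
  by (simp_all add: blk_def pick_def)

lemma pdet_Tact:
  "nondegenerate (pick i j k s) \<Longrightarrow> pdet (blk (Tact i j k s) l) = pdet (blk s l)"
  by (simp add: blk_Tact pdet_Tmap blk_pick)

text \<open>Here \<open>i\<close>, \<open>j\<close>, \<open>k\<close> number the factors of the
  six-fold product, while \<open>a\<close>, \<open>b\<close>, \<open>c\<close> are rows of the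
  matrices.\<close>

lemma lax_Tact:
  assumes "nondegenerate (pick i j k s)" "distinct [i, j, k]" "distinct [a, b, c]"
  shows "lax a b (blk (Tact i j k s) i) (lax a c (blk (Tact i j k s) j)
           (lax b c (blk (Tact i j k s) k) f))
       = lax b c (blk s k) (lax a c (blk s j) (lax a b (blk s i) f))"
  using lax_refactorises[OF refactorises_Tmap[OF assms(1)] assms(3), of f] assms(2)
  by (auto simp: blk_Tact blk_pick)

text \<open>
  Index the factors \<open>1, \<dots>, 6\<close> by the pairs \<open>12, 13, 23, 14, 24, 34\<close>. Each of the four maps reverses
  the order of three neighbouring factors of the product
  \<open>M34 M24 M14 M23 M13 M12\<close>, so both sides of the tetrahedron equation refactorise it as
  \<open>M12 M13 M23 M14 M24 M34\<close>, with the same determinants.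
\<close>

lemma tetrahedron_equation_pointwise:
  fixes s :: "6 \<times> 3 \<Rightarrow> 'a::field"
  defines "a1 \<equiv> Tact 3 5 6 s" and "a2 \<equiv> Tact 2 4 6 (Tact 3 5 6 s)"
    and "a3 \<equiv> Tact 1 4 5 (Tact 2 4 6 (Tact 3 5 6 s))"
    and "b1 \<equiv> Tact 1 2 3 s" and "b2 \<equiv> Tact 1 4 5 (Tact 1 2 3 s)"
    and "b3 \<equiv> Tact 2 4 6 (Tact 1 4 5 (Tact 1 2 3 s))"
  assumes nd: "nondegenerate (pick 3 5 6 s)" "nondegenerate (pick 2 4 6 a1)"
      "nondegenerate (pick 1 4 5 a2)" "nondegenerate (pick 1 2 3 a3)"
      "nondegenerate (pick 1 2 3 s)" "nondegenerate (pick 1 4 5 b1)"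
      "nondegenerate (pick 2 4 6 b2)" "nondegenerate (pick 3 5 6 b3)"
    and det: "\<And>l. pdet (blk s l) \<noteq> 0" and nz: "\<And>l. Tact 1 2 3 a3 (l, 3) \<noteq> 0"
  shows "Tact 1 2 3 a3 = Tact 3 5 6 b3"
proof -
  define a4 b4 where "a4 = Tact 1 2 3 a3" and "b4 = Tact 3 5 6 b3"
  have a: "a2 = Tact 2 4 6 a1" "a3 = Tact 1 4 5 a2"
    and b: "b2 = Tact 1 4 5 b1" "b3 = Tact 2 4 6 b2"
    unfolding assms by simp_all
  have det_a: "pdet (blk a4 l) = pdet (blk s l)" for l
    unfolding a4_def a a1_def using nd a by (simp add: pdet_Tact a1_def)
  have det_b: "pdet (blk b4 l) = pdet (blk s l)" for l
    unfolding b4_def b b1_def using nd b by (simp add: pdet_Tact b1_def)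
  have keep: "l \<noteq> i \<Longrightarrow> l \<noteq> j \<Longrightarrow> l \<noteq> k \<Longrightarrow> blk (Tact i j k r) l = blk r l"
    for i j k l :: 6 and r :: "6 \<times> 3 \<Rightarrow> 'a"
    by (simp add: blk_Tact)
  have keep_a:
    "blk a1 1 = blk s 1" "blk a1 2 = blk s 2" "blk a1 4 = blk s 4"
    "blk a2 1 = blk a1 1" "blk a2 3 = blk a1 3" "blk a2 5 = blk a1 5"
    "blk a3 2 = blk a2 2" "blk a3 3 = blk a2 3" "blk a3 6 = blk a2 6"
    "blk a4 4 = blk a3 4" "blk a4 5 = blk a3 5" "blk a4 6 = blk a3 6"
    unfolding a4_def a a1_def by (rule keep; simp)+
  have keep_b:
    "blk b1 4 = blk s 4" "blk b1 5 = blk s 5" "blk b1 6 = blk s 6"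
    "blk b2 2 = blk b1 2" "blk b2 3 = blk b1 3" "blk b2 6 = blk b1 6"
    "blk b3 1 = blk b2 1" "blk b3 3 = blk b2 3" "blk b3 5 = blk b2 5"
    "blk b4 1 = blk b3 1" "blk b4 2 = blk b3 2" "blk b4 4 = blk b3 4"
    unfolding b4_def b b1_def by (rule keep; simp)+
  let ?R = "\<lambda>f. lax (3::nat) 4 (blk s 6) (lax 2 4 (blk s 5) (lax 1 4 (blk s 4)
     (lax 2 3 (blk s 3) (lax 1 3 (blk s 2) (lax 1 2 (blk s 1) f)))))"
  have A: "lax_product (blk a4) f = ?R f" for f
  proof -
    \<comment> \<open>Facts 4, 3, 2, 1 undo the four maps, the last applied first.\<close>
    have 4: "lax 1 2 (blk a4 1) (lax 1 3 (blk a4 2) (lax (2::nat) 3 (blk a4 3) f))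
        = lax 2 3 (blk a3 3) (lax 1 3 (blk a3 2) (lax 1 2 (blk a3 1) f))" for f
      unfolding a4_def by (rule lax_Tact[OF nd(4)]) simp_all
    have 3: "lax 1 2 (blk a3 1) (lax 1 4 (blk a3 4) (lax (2::nat) 4 (blk a3 5) f))
        = lax 2 4 (blk a2 5) (lax 1 4 (blk a2 4) (lax 1 2 (blk a2 1) f))" for f
      unfolding a by (rule lax_Tact[OF nd(3)[unfolded a]]) simp_all
    have 2: "lax 1 3 (blk a2 2) (lax 1 4 (blk a2 4) (lax (3::nat) 4 (blk a2 6) f))
        = lax 3 4 (blk a1 6) (lax 1 4 (blk a1 4) (lax 1 3 (blk a1 2) f))" for f
      unfolding a by (rule lax_Tact[OF nd(2)]) simp_all
    have 1: "lax 2 3 (blk a1 3) (lax 2 4 (blk a1 5) (lax (3::nat) 4 (blk a1 6) f))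
        = lax 3 4 (blk s 6) (lax 2 4 (blk s 5) (lax 2 3 (blk s 3) f))" for f
      unfolding a1_def by (rule lax_Tact[OF nd(1)]) simp_all
    have "lax_product (blk a4) f = lax 2 3 (blk a2 3) (lax 1 3 (blk a2 2) (lax 2 4 (blk a2 5)
        (lax 1 4 (blk a2 4) (lax 1 2 (blk a2 1) (lax 3 4 (blk a2 6) f)))))"
      unfolding lax_product_def by (simp only: 4 keep_a(7-12) 3)
    \<comment> \<open>Factors on disjoint pairs commute: moving 13 past 24 and 12 past 34 makes 13,
      14, 34 neighbours.\<close>
    also have "\<dots> = lax 2 3 (blk a2 3) (lax 2 4 (blk a2 5) (lax 1 3 (blk a2 2)
        (lax 1 4 (blk a2 4) (lax 3 4 (blk a2 6) (lax 1 2 (blk a2 1) f)))))"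
      by (simp add: lax_commute[of 1 3 2 4] lax_commute[of 1 2 3 4] del: One_nat_def)
    also have "\<dots> = lax 2 3 (blk a1 3) (lax 2 4 (blk a1 5) (lax 3 4 (blk a1 6)
        (lax 1 4 (blk a1 4) (lax 1 3 (blk a1 2) (lax 1 2 (blk a1 1) f)))))"
      by (simp only: 2 keep_a(4-6))
    also have "\<dots> = lax 3 4 (blk s 6) (lax 2 4 (blk s 5) (lax 2 3 (blk s 3) (lax 1 4 (blk s 4)
        (lax 1 3 (blk s 2) (lax 1 2 (blk s 1) f)))))"
      by (simp only: 1 keep_a(1-3))
    also have "\<dots> = ?R f"
      by (simp add: lax_commute[of 2 3 1 4] del: One_nat_def)
    finally show ?thesis .
  qed
  have B: "lax_product (blk b4) f = ?R f" for f
  proof -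
    have 4: "lax 2 3 (blk b4 3) (lax 2 4 (blk b4 5) (lax (3::nat) 4 (blk b4 6) f))
        = lax 3 4 (blk b3 6) (lax 2 4 (blk b3 5) (lax 2 3 (blk b3 3) f))" for f
      unfolding b4_def by (rule lax_Tact[OF nd(8)]) simp_all
    have 3: "lax 1 3 (blk b3 2) (lax 1 4 (blk b3 4) (lax (3::nat) 4 (blk b3 6) f))
        = lax 3 4 (blk b2 6) (lax 1 4 (blk b2 4) (lax 1 3 (blk b2 2) f))" for f
      unfolding b by (rule lax_Tact[OF nd(7)[unfolded b]]) simp_all
    have 2: "lax 1 2 (blk b2 1) (lax 1 4 (blk b2 4) (lax (2::nat) 4 (blk b2 5) f))
        = lax 2 4 (blk b1 5) (lax 1 4 (blk b1 4) (lax 1 2 (blk b1 1) f))" for f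
      unfolding b by (rule lax_Tact[OF nd(6)]) simp_all
    have 1: "lax 1 2 (blk b1 1) (lax 1 3 (blk b1 2) (lax (2::nat) 3 (blk b1 3) f))
        = lax 2 3 (blk s 3) (lax 1 3 (blk s 2) (lax 1 2 (blk s 1) f))" for f
      unfolding b1_def by (rule lax_Tact[OF nd(5)]) simp_all
    \<comment> \<open>On this side 14 must first move past 23, so that 23, 24, 34 become
      neighbours.\<close>
    have "lax_product (blk b4) f = lax 1 2 (blk b4 1) (lax 1 3 (blk b4 2) (lax 1 4 (blk b4 4)
        (lax 2 3 (blk b4 3) (lax 2 4 (blk b4 5) (lax 3 4 (blk b4 6) f)))))"
      unfolding lax_product_def by (simp add: lax_commute[of 2 3 1 4] del: One_nat_def)
    also have "\<dots> = lax 1 2 (blk b2 1) (lax 3 4 (blk b2 6) (lax 1 4 (blk b2 4)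
        (lax 1 3 (blk b2 2) (lax 2 4 (blk b2 5) (lax 2 3 (blk b2 3) f)))))"
      by (simp only: 4 keep_b(7-12) 3)
    also have "\<dots> = lax 3 4 (blk b2 6) (lax 1 2 (blk b2 1) (lax 1 4 (blk b2 4)
        (lax 2 4 (blk b2 5) (lax 1 3 (blk b2 2) (lax 2 3 (blk b2 3) f)))))"
      by (simp add: lax_commute[of 1 3 2 4] lax_commute[of 1 2 3 4] del: One_nat_def)
    also have "\<dots> = ?R f"
      by (simp only: 2 keep_b(4-6) 1 keep_b(1-3))
    finally show ?thesis .
  qed
  have "blk a4 = blk b4"
  proof (rule lax_product_inject)
    show "lax_product (blk a4) = lax_product (blk b4)"
      using A B by (simp add: fun_eq_iff)
  qed (use det_a det_b det nz in \<open>simp_all add: a4_def[symmetric] blk_def\<close>)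
  then have "a4 = b4"
    by (auto simp: blk_def fun_eq_iff)
  then show ?thesis
    by (simp add: a4_def b4_def)
qed

section \<open>The map over the field of rational functions\<close>

text \<open>\<open>Tmap\<close> consists of field operations, which \<open>substs_to\<close>
  respects while the denominators at \<open>t\<close> are nonzero. This turns composition into
  evaluation at a tuple.\<close>

lemma substs_to_Tmap:
  assumes s: "\<And>i. substs_to a (s i) (t i)" and nd: "nondegenerate t"
  shows "substs_to a (Tmap s i) (Tmap t i)"
proof -
  note nz = nd[unfolded nondegenerate_def]
  show ?thesis
    by (cases i rule: exhaust_3_3; simp only: Tmap_simps;
        intro substs_to_intros s; use nz in simp)
qed

lemma nondegenerate_substs_to:
  assumes s: "\<And>i. substs_to a (s i) (t i)" and nd: "nondegenerate t"
  shows "nondegenerate s"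
  unfolding nondegenerate_def
  by (intro conjI; (rule substs_to_nonzero[of a], ((rule substs_to_intros s)+)[1],
      use nd in \<open>simp add: nondegenerate_def\<close>))

lemma substs_to_Tact:
  assumes s: "\<And>i. substs_to a (s i) (t i)" and nd: "nondegenerate (pick i j k t)"
  shows "substs_to a (Tact i j k s v) (Tact i j k t v)"
proof -
  have "substs_to a (pick i j k s w) (pick i j k t w)" for w
    using s by (simp add: pick_def split_beta)
  then have "substs_to a (Tmap (pick i j k s) w) (Tmap (pick i j k t) w)" for w
    by (rule substs_to_Tmap[OF _ nd])
  then show ?thesis
    using s by (simp add: Tact_def split_beta)
qed

text \<open>
  At the point with all blocks equal to \<^const>\<open>trivial_block\<close>, which is fixed by the map, none of
  the denominators vanishes. Hence no composite of such maps meets an indeterminacy locus.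
\<close>

definition base_point :: "'n \<times> 3 \<Rightarrow> 'a::field" where
  "base_point = (\<lambda>(l, c). trivial_block c)"

text \<open>\<open>g\<close> is defined at the base point and sends it to the base point, a property
  that the constructions below preserve.\<close>

definition regular_near_base :: "('n::linorder \<times> 3, 'm \<times> 3) ratmap \<Rightarrow> bool" where
  "regular_near_base g \<longleftrightarrow>
     (\<forall>i. substs_to (base_point :: 'n \<times> 3 \<Rightarrow> ('n \<times> 3) ratfun) (g i) (base_point i))"

lemma nondegenerate_base: "nondegenerate base_point"
  by (simp add: nondegenerate_def base_point_def trivial_block_def)

lemma Tmap_base: "Tmap base_point = base_point"
proof
  fix i
  show "Tmap base_point i = (base_point i :: 'a)"
    by (cases i rule: exhaust_3_3) (simp_all add: Tmap_simps, simp_all add: base_point_def trivial_block_def)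
qed

lemma pick_base: "pick i j k base_point = base_point"
  by (auto simp: pick_def base_point_def)

lemma Tact_base: "Tact i j k base_point = base_point"
  by (rule ext) (simp add: Tact_def pick_base Tmap_base split_beta, simp add: base_point_def split_beta)

lemma regular_near_baseD:
  fixes g :: "('n::linorder \<times> 3, 'm \<times> 3) ratmap"
  assumes "regular_near_base g"
  shows "substs_to (base_point :: 'n \<times> 3 \<Rightarrow> ('n \<times> 3) ratfun) (g i) (base_point i)"
  using assms unfolding regular_near_base_def by blast

lemma regular_near_base_ratvar: "regular_near_base ratvar"
  by (simp add: regular_near_base_def substs_to_ratvar)

lemma regular_near_base_swap_offdiag: "regular_near_base g \<Longrightarrow> regular_near_base (g \<circ> swap_offdiag)"
proof -
  have "base_point (swap_offdiag i) = base_point i" for i :: "'m \<times> 3"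
    by (cases i) (simp add: base_point_def swap_offdiag_def trivial_block_def)
  then show "regular_near_base g \<Longrightarrow> regular_near_base (g \<circ> swap_offdiag)"
    unfolding regular_near_base_def by (metis comp_apply)
qed

lemma regular_near_base_Tmap: "regular_near_base g \<Longrightarrow> regular_near_base (Tmap g)"
  using substs_to_Tmap[OF _ nondegenerate_base] by (metis regular_near_base_def Tmap_base)

lemma regular_near_base_pick: "regular_near_base g \<Longrightarrow> regular_near_base (pick i j k g)"
  unfolding regular_near_base_def by (simp add: pick_def base_point_def split_beta)

lemma regular_near_base_Tact: "regular_near_base g \<Longrightarrow> regular_near_base (Tact i j k g)"
  unfolding regular_near_base_def
  using substs_to_Tact[where t = base_point] by (metis Tact_base pick_base nondegenerate_base)

lemma regular_near_base_nondegenerate: "regular_near_base g \<Longrightarrow> nondegenerate g"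
  using nondegenerate_substs_to nondegenerate_base unfolding regular_near_base_def by blast

lemma nondegenerate_pick: "regular_near_base g \<Longrightarrow> nondegenerate (pick i j k g)"
  by (simp add: regular_near_base_nondegenerate regular_near_base_pick)

lemma pdet_regular_near_base:
  fixes g :: "('n::linorder \<times> 3, 'm \<times> 3) ratmap"
  assumes "regular_near_base g"
  shows "pdet (blk g l) \<noteq> 0"
proof (rule substs_to_nonzero)
  show "substs_to (base_point :: 'n \<times> 3 \<Rightarrow> ('n \<times> 3) ratfun) (pdet (blk g l))
      (pdet (blk base_point l))"
    unfolding pdet_def blk_def
    by (intro substs_to_intros regular_near_baseD[OF assms])
qed (simp add: base_point_def blk_def pdet_def trivial_block_def)

lemma regular_near_base_nonzero:
  assumes "regular_near_base g"
  shows "g (l, 3) \<noteq> 0"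
  by (rule substs_to_nonzero[OF regular_near_baseD[OF assms]])
    (simp add: base_point_def trivial_block_def)

section \<open>From points to rational maps\<close>

lemma ratcompI:
  assumes "\<And>i. substs_to g (f i) (h i)"
  shows "composable f g" and "ratcomp f g = h"
  using assms by (auto simp: composable_def ratcomp_def intro: regular_atI ratsubst_eqI)

lemma birational_Tmap: "birational (Tmap ratvar)"
proof -
  let ?T = "Tmap ratvar :: (3 \<times> 3, 3 \<times> 3) ratmap"
  let ?r = "ratvar \<circ> swap_offdiag :: (3 \<times> 3, 3 \<times> 3) ratmap"
  define S :: "(3 \<times> 3, 3 \<times> 3) ratmap" where "S = Tmap ?r \<circ> swap_offdiag"
  note reg = regular_near_base_ratvar regular_near_base_swap_offdiag regular_near_base_Tmap
  have nd: "nondegenerate (ratvar :: (3 \<times> 3, 3 \<times> 3) ratmap)" "nondegenerate (?T \<circ> swap_offdiag)"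
    "nondegenerate ?r" "nondegenerate S"
    using regular_near_base_nondegenerate reg unfolding S_def by blast+
  have ST: "substs_to ?T (S i) (ratvar i)" for i
  proof -
    have "substs_to ?T (S i) ((Tmap (?T \<circ> swap_offdiag) \<circ> swap_offdiag) i)"
      unfolding S_def comp_apply[of _ swap_offdiag i]
      by (rule substs_to_Tmap[OF _ nd(2)]) (simp add: substs_to_ratvar)
    then show ?thesis
      by (simp only: Tmap_swap_offdiag_Tmap[OF nd(1,2)])
  qed
  have TS: "substs_to S (?T i) (ratvar i)" for i
  proof -
    \<comment> \<open>The identity used for \<open>ST\<close>, now at the swapped generic point
      \<open>?r\<close>; the outer swap is then cancelled.\<close>
    have "Tmap S \<circ> swap_offdiag = ?r"
      unfolding S_def using nd(3,4)[unfolded S_def] by (rule Tmap_swap_offdiag_Tmap)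
    then have "Tmap S = ratvar"
      by (metis comp_assoc comp_id swap_offdiag_swap_offdiag)
    moreover have "substs_to S (?T i) (Tmap S i)"
      by (rule substs_to_Tmap[OF substs_to_ratvar nd(4)])
    ultimately show ?thesis by simp
  qed
  show ?thesis
    unfolding birational_def by (intro exI[of _ S] conjI ratcompI[where f = S and h = ratvar, OF ST]
        ratcompI[where f = ?T and h = ratvar, OF TS])
qed

text \<open>Renaming variables is a substitution too, and a regular one because the picked variables
  are nondegenerate.\<close>

lemma act_on_Tmap: "act_on (Tmap ratvar) i j k = Tact i j k ratvar"
proof -
  let ?r = "\<lambda>(s, d). ratvar (if s = 1 then i else if s = 2 then j else k, d)"
  have r: "?r = pick i j k ratvar"
    by (simp add: pick_def)
  have "ratsubst ?r (Tmap ratvar v) = Tmap (pick i j k ratvar) v" for v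
    unfolding r
    by (intro ratsubst_eqI substs_to_Tmap substs_to_ratvar nondegenerate_pick
        regular_near_base_ratvar)
  then show ?thesis
    by (intro ext) (simp add: act_on_def Tact_def Let_def split_beta)
qed

lemma ratcomp_Tact:
  assumes "regular_near_base g"
  shows "composable (Tact i j k ratvar) g" and "ratcomp (Tact i j k ratvar) g = Tact i j k g"
  by (intro ratcompI[where h = "Tact i j k g"] substs_to_Tact substs_to_ratvar
      nondegenerate_pick assms)+

text \<open>The pointwise equation at the generic point \<open>ratvar\<close> is the identity of
  rational maps, since iterated \<open>ratcomp\<close> becomes iterated \<open>Tact\<close>.\<close>

lemma tetrahedron_map_Tmap: "tetrahedron_map (Tmap ratvar)"
proof -
  note reg = regular_near_base_ratvar regular_near_base_Tact
  let ?T = "\<lambda>i j k. Tact i j k :: (6 \<times> 3, 6 \<times> 3) ratmap \<Rightarrow> _"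
  have "?T 1 2 3 (?T 1 4 5 (?T 2 4 6 (?T 3 5 6 ratvar)))
      = ?T 3 5 6 (?T 2 4 6 (?T 1 4 5 (?T 1 2 3 ratvar)))"
    by (intro tetrahedron_equation_pointwise nondegenerate_pick pdet_regular_near_base
        regular_near_base_nonzero reg)
  then show ?thesis
    by (simp add: tetrahedron_map_def act_on_Tmap ratcomp_Tact reg Let_def)
qed

theorem proposition5p1:
  fixes x1 x2 X y1 y2 Y z1 z2 Z E :: "(3 \<times> 3) ratfun"
    and T :: "(3 \<times> 3, 3 \<times> 3) ratmap"
  assumes "x1 = ratvar (1, 1)" and "x2 = ratvar (1, 2)" and "X = ratvar (1, 3)"
    and "y1 = ratvar (2, 1)" and "y2 = ratvar (2, 2)" and "Y = ratvar (2, 3)"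
    and "z1 = ratvar (3, 1)" and "z2 = ratvar (3, 2)" and "Z = ratvar (3, 3)"
    and "E = 1 + x2 * y1 * z2 * Z
               + (y1 * y2 * Y - 1) * (x1 * (x2 + y2 * z1 * Y) * X + z1 * z2 * Z)"
    and "T (1, 1) = (E * (x1 * X * (y1 * y2 * Y - 1) + y1 * z2 * Z) * Y)
                    / ((x1 * x2 * X - 1) * X * (z1 * z2 * Z - 1)^2 * Z)"
    and "T (1, 2) = (x2 + y2 * z1 * Y) * (Z / Y)"
    and "T (1, 3) = ((x1 * x2 * X - 1) * X * (z1 * z2 * Z - 1)) / E"
    and "T (2, 1) = (y1 + x1 * z1 * X * (y1 * y2 * Y - 1)) / (E * X)"
    and "T (2, 2) = ((x1 * x2 * X - 1) * X * (y2 * Y + x2 * z2 * Z) * (z1 * z2 * Z - 1)) / (E * Y)"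
    and "T (2, 3) = (E * Y) / ((x1 * x2 * X - 1) * (z1 * z2 * Z - 1))"
    and "T (3, 1) = (x2 * y1 + z1 * (y1 * y2 * Y - 1)) / (x1 * x2 * X - 1)"
    and "T (3, 2) = ((x1 * y2 * X * Y + z2 * Z) * E)
                    / ((x1 * x2 * X - 1) * (z1 * z2 * Z - 1) * Z)"
    and "T (3, 3) = ((x1 * x2 * X - 1) * (z1 * z2 * Z - 1) * Z) / E"
  shows "(\<forall>u1 u2 U v1 v2 V w1 w2 W :: (3 \<times> 3) ratfun.
            (emb12 (Mmat u1 u2 U) ** emb13 (Mmat v1 v2 V) ** emb23 (Mmat w1 w2 W)
               = emb23 (Mmat z1 z2 Z) ** emb13 (Mmat y1 y2 Y) ** emb12 (Mmat x1 x2 X)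
             \<and> U - u1 * u2 * U^2 = X - x1 * x2 * X^2)
            \<longleftrightarrow>
            (u1 = T (1, 1) \<and> u2 = T (1, 2) \<and> U = T (1, 3)
             \<and> v1 = T (2, 1) \<and> v2 = T (2, 2) \<and> V = T (2, 3)
             \<and> w1 = T (3, 1) \<and> w2 = T (3, 2) \<and> W = T (3, 3)))
         \<and> birational T \<and> tetrahedron_map T"
proof -
  have T: "T = Tmap ratvar"
  proof
    fix i
    show "T i = Tmap ratvar i"
      by (cases i rule: exhaust_3_3) (simp_all only: Tmap_simps assms)
  qed
  have "(emb12 (Mmat u1 u2 U) ** emb13 (Mmat v1 v2 V) ** emb23 (Mmat w1 w2 W)
               = emb23 (Mmat z1 z2 Z) ** emb13 (Mmat y1 y2 Y) ** emb12 (Mmat x1 x2 X)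
             \<and> U - u1 * u2 * U^2 = X - x1 * x2 * X^2)
            \<longleftrightarrow>
            (u1 = T (1, 1) \<and> u2 = T (1, 2) \<and> U = T (1, 3)
             \<and> v1 = T (2, 1) \<and> v2 = T (2, 2) \<and> V = T (2, 3)
             \<and> w1 = T (3, 1) \<and> w2 = T (3, 2) \<and> W = T (3, 3))" (is "?L \<longleftrightarrow> ?R")
    for u1 u2 U v1 v2 V w1 w2 W
  proof -
    define t :: "(3 \<times> 3, 3 \<times> 3) ratmap" where
      "t = (\<lambda>_. 0)((1, 1) := u1, (1, 2) := u2, (1, 3) := U, (2, 1) := v1, (2, 2) := v2,
         (2, 3) := V, (3, 1) := w1, (3, 2) := w2, (3, 3) := W)"
    have t: "t (1, 1) = u1" "t (1, 2) = u2" "t (1, 3) = U" "t (2, 1) = v1" "t (2, 2) = v2"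
      "t (2, 3) = V" "t (3, 1) = w1" "t (3, 2) = w2" "t (3, 3) = W"
      by (simp_all add: t_def)
    have "?L \<longleftrightarrow> refactorises ratvar t"
      by (simp only: refactorises_def t assms(1-9))
    also have "\<dots> \<longleftrightarrow> t = T"
      unfolding T by (intro refactorises_iff regular_near_base_nondegenerate regular_near_base_ratvar)
    also have "\<dots> \<longleftrightarrow> ?R"
    proof
      assume ?R
      then have "t i = T i" for i
        by (cases i rule: exhaust_3_3) (simp_all only: t)
      then show "t = T" by (rule ext)
    qed (use t in auto)
    finally show ?thesis .
  qed
  then show ?thesis
    using birational_Tmap tetrahedron_map_Tmap T by blast
qed

end
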